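(* Let $|T| = \tau \geq \omega$ and let $Z$ be a $Z_{\tau}$-set in the Tychonov cube $I^{T}$. Suppose that $Y$ is closed in a compactum $X$ of weight $\leq \tau$ and $f \colon X \to I^{T}$ is a map such that $f(Y) \subset Z$ and $f|Y \colon Y \to Z$ is an embedding. Then there exists a $Z_{\tau}$-embedding $h \colon X \to I^{T}$ such that $h|Y = f|Y$ and $h(X\setminus Y) \subset I^{T}\setminus Z$.
   Context: A compactum is a compact Hausdorff space; maps are continuous; $I=[0,1]$. A $Z_\tau$-embedding is an embedding whose image is a $Z_\tau$-set. $Z_\tau$-sets: for a Tychonov space $Y$ let $\operatorname{cov}(Y)$ be the collection of all countable covers of $Y$ by functionally open (cozero) sets. Maps $f,g\colon X\to Y$ are ${\mathcal U}$-close if for each $x\in X$ some $U\in{\mathcal U}$ contains both $f(x)$ and $g(x)$. For an infinite cardinal $\tau$, $C_\tau(X,Y)$ is the set of continuous maps $X\to Y$ with the topology in which $G$ is open iff for each $h\in G$ there is a family $\{{\mathcal U}_s\colon s\in S\}\subseteq\operatorname{cov}(Y)$ with $|S|<\tau$ such that every $g$ that is ${\mathcal U}_s$-close to $h$ for all $s\in S$ belongs to $G$. A closed subset $A\subset X$ is a $Z_\tau$-set in $X$ if $\{f\in C_\tau(X,X)\colon f(X)\cap A=\emptyset\}$ is dense in $C_\tau(X,X)$. *)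

theory Defs
  imports "HOL-Analysis.Analysis"
begin

unbundle cardinal_syntax

definition base_of_topology :: "'a topology \<Rightarrow> 'a set set \<Rightarrow> bool" where
  "base_of_topology X \<B> \<longleftrightarrow>
     (\<forall>V \<in> \<B>. openin X V) \<and>
     (\<forall>U x. openin X U \<and> x \<in> U \<longrightarrow> (\<exists>V \<in> \<B>. x \<in> V \<and> V \<subseteq> U))"

(* The least cardinality of a base; since the base that is chosen is one of least
   cardinality, the result does not depend on the choice up to =o. *)
definition topology_weight :: "'a topology \<Rightarrow> 'a set rel" where
  "topology_weight X =
     |SOME \<B>. base_of_topology X \<B> \<and> (\<forall>\<C>. base_of_topology X \<C> \<longrightarrow> |\<B>| \<le>o |\<C>| )|"

definition compactum :: "'a topology \<Rightarrow> bool" where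
  "compactum X \<longleftrightarrow> compact_space X \<and> Hausdorff_space X"

definition tychonov_cube :: "'i set \<Rightarrow> ('i \<Rightarrow> real) topology" where
  "tychonov_cube T = product_topology (\<lambda>i. top_of_set {0..1}) T"

definition functionally_open_in :: "'a topology \<Rightarrow> 'a set \<Rightarrow> bool" where
  "functionally_open_in Y U \<longleftrightarrow>
     (\<exists>\<phi>. continuous_map Y euclideanreal \<phi> \<and> U = {y \<in> topspace Y. \<phi> y \<noteq> 0})"

definition cov :: "'a topology \<Rightarrow> 'a set set set" where
  "cov Y = {\<U>. countable \<U> \<and> (\<forall>U \<in> \<U>. functionally_open_in Y U) \<and> \<Union>\<U> = topspace Y}"

definition close_maps :: "'a topology \<Rightarrow> 'b set set \<Rightarrow> ('a \<Rightarrow> 'b) \<Rightarrow> ('a \<Rightarrow> 'b) \<Rightarrow> bool" where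
  "close_maps X \<U> f g \<longleftrightarrow> (\<forall>x \<in> topspace X. \<exists>U \<in> \<U>. f x \<in> U \<and> g x \<in> U)"

(* Extensionality makes functions that agree on the space represent the same map. *)
definition cmaps :: "'a topology \<Rightarrow> 'b topology \<Rightarrow> ('a \<Rightarrow> 'b) set" where
  "cmaps X Y = {f \<in> extensional (topspace X). continuous_map X Y f}"

(* An indexed family of covers matters only through the set of its members, so it is
   given as a set of covers of cardinality less than \<tau>. *)
definition openin_C :: "'k rel \<Rightarrow> 'a topology \<Rightarrow> 'b topology \<Rightarrow> ('a \<Rightarrow> 'b) set \<Rightarrow> bool" where
  "openin_C \<tau> X Y G \<longleftrightarrow>
     G \<subseteq> cmaps X Y \<and>
     (\<forall>h \<in> G. \<exists>\<S> \<subseteq> cov Y. |\<S>| <o \<tau> \<and>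
        (\<forall>g \<in> cmaps X Y. (\<forall>\<U> \<in> \<S>. close_maps X \<U> g h) \<longrightarrow> g \<in> G))"

(* Meaningful for infinite cardinals \<tau>, see istopology_openin_C. *)
definition C_space :: "'k rel \<Rightarrow> 'a topology \<Rightarrow> 'b topology \<Rightarrow> ('a \<Rightarrow> 'b) topology" where
  "C_space \<tau> X Y = topology (openin_C \<tau> X Y)"

definition Z_set_in :: "'k rel \<Rightarrow> 'a topology \<Rightarrow> 'a set \<Rightarrow> bool" where
  "Z_set_in \<tau> X A \<longleftrightarrow>
     closedin X A \<and>
     C_space \<tau> X X closure_of {f \<in> cmaps X X. f ` topspace X \<inter> A = {}}
       = topspace (C_space \<tau> X X)"

definition Z_embedding :: "'k rel \<Rightarrow> 'a topology \<Rightarrow> 'b topology \<Rightarrow> ('a \<Rightarrow> 'b) \<Rightarrow> bool" where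
  "Z_embedding \<tau> X Y h \<longleftrightarrow> embedding_map X Y h \<and> Z_set_in \<tau> Y (h ` topspace X)"

lemma topology_weight_properties:
  "\<exists>\<B>. base_of_topology X \<B> \<and> topology_weight X = |\<B>| \<and>
       (\<forall>\<C>. base_of_topology X \<C> \<longrightarrow> |\<B>| \<le>o |\<C>| )"
proof -
  let ?R = "card_of ` {\<C>. base_of_topology X \<C>}"
  have "base_of_topology X {U. openin X U}"
    unfolding base_of_topology_def by auto
  then have "?R \<noteq> {}" by blast
  moreover have "\<forall>r \<in> ?R. Card_order r"
    by (simp add: card_of_Card_order)
  ultimately have "\<exists>r \<in> ?R. \<forall>r' \<in> ?R. r \<le>o r'"
    by (rule exists_minim_Card_order)
  then obtain r where "r \<in> ?R" "\<forall>r' \<in> ?R. r \<le>o r'"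
    by (elim bexE)
  then have "\<exists>\<B>. base_of_topology X \<B> \<and> (\<forall>\<C>. base_of_topology X \<C> \<longrightarrow> |\<B>| \<le>o |\<C>| )"
    by (elim imageE) auto
  note choice = someI_ex[OF this]
  show ?thesis
    unfolding topology_weight_def
    by (rule exI, rule conjI[OF choice[THEN conjunct1] conjI[OF refl choice[THEN conjunct2]]])
qed

lemma topology_weight_le_iff:
  "topology_weight X \<le>o r \<longleftrightarrow> (\<exists>\<B>. base_of_topology X \<B> \<and> |\<B>| \<le>o r)"
proof -
  obtain \<B> where B: "base_of_topology X \<B>" "topology_weight X = |\<B>|"
    "\<forall>\<C>. base_of_topology X \<C> \<longrightarrow> |\<B>| \<le>o |\<C>|"
    using topology_weight_properties[of X] by (elim exE conjE)
  have "|\<B>| \<le>o r" if "base_of_topology X \<C>" "|\<C>| \<le>o r" for \<C>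
    by (rule ordLeq_transitive[OF B(3)[rule_format, OF that(1)] that(2)])
  then show ?thesis
    unfolding B(2) using B(1) by auto
qed

lemma infinite_Field_cardinal:
  assumes "Card_order \<tau>" "natLeq \<le>o \<tau>"
  shows "infinite (Field \<tau>)"
proof -
  have "natLeq \<le>o |Field \<tau>|"
    by (rule ordLeq_ordIso_trans[OF assms(2) ordIso_symmetric[OF card_of_Field_ordIso[OF assms(1)]]])
  then show ?thesis
    using infinite_iff_natLeq_ordLeq[of "Field \<tau>"] by simp
qed

lemma istopology_openin_C:
  assumes "Card_order \<tau>" "natLeq \<le>o \<tau>"
  shows "istopology (openin_C \<tau> X Y)"
  unfolding istopology_def
proof (intro conjI allI impI)
  have inf: "infinite (Field \<tau>)"
    by (rule infinite_Field_cardinal[OF assms])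
  fix G H assume G: "openin_C \<tau> X Y G" and H: "openin_C \<tau> X Y H"
  show "openin_C \<tau> X Y (G \<inter> H)"
    unfolding openin_C_def
  proof (intro conjI ballI)
    show "G \<inter> H \<subseteq> cmaps X Y" using G unfolding openin_C_def by blast
    fix h assume h: "h \<in> G \<inter> H"
    obtain \<S> where S: "\<S> \<subseteq> cov Y" "|\<S>| <o \<tau>"
      "\<forall>g \<in> cmaps X Y. (\<forall>\<U> \<in> \<S>. close_maps X \<U> g h) \<longrightarrow> g \<in> G"
      using G h unfolding openin_C_def by blast
    obtain \<R> where R: "\<R> \<subseteq> cov Y" "|\<R>| <o \<tau>"
      "\<forall>g \<in> cmaps X Y. (\<forall>\<U> \<in> \<R>. close_maps X \<U> g h) \<longrightarrow> g \<in> H"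
      using H h unfolding openin_C_def by blast
    have "|\<S> \<union> \<R>| <o \<tau>"
      by (rule card_of_Un_ordLess_infinite_Field[OF inf assms(1) S(2) R(2)])
    then show "\<exists>\<S> \<subseteq> cov Y. |\<S>| <o \<tau> \<and>
        (\<forall>g \<in> cmaps X Y. (\<forall>\<U> \<in> \<S>. close_maps X \<U> g h) \<longrightarrow> g \<in> G \<inter> H)"
      using S R by (intro exI[of _ "\<S> \<union> \<R>"]) auto
  qed
next
  fix \<G> assume G: "\<forall>G \<in> \<G>. openin_C \<tau> X Y G"
  show "openin_C \<tau> X Y (\<Union>\<G>)"
    unfolding openin_C_def
  proof (intro conjI ballI)
    show "\<Union>\<G> \<subseteq> cmaps X Y" using G unfolding openin_C_def by blast
    fix h assume "h \<in> \<Union>\<G>"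
    then obtain G where Gh: "G \<in> \<G>" "h \<in> G" by blast
    with G have "openin_C \<tau> X Y G" by blast
    with Gh obtain \<S> where "\<S> \<subseteq> cov Y" "|\<S>| <o \<tau>"
      "\<forall>g \<in> cmaps X Y. (\<forall>\<U> \<in> \<S>. close_maps X \<U> g h) \<longrightarrow> g \<in> G"
      unfolding openin_C_def by blast
    with Gh show "\<exists>\<S> \<subseteq> cov Y. |\<S>| <o \<tau> \<and>
        (\<forall>g \<in> cmaps X Y. (\<forall>\<U> \<in> \<S>. close_maps X \<U> g h) \<longrightarrow> g \<in> \<Union>\<G>)"
      by (intro exI[of _ \<S>]) auto
  qed
qed

lemma openin_C_space:
  assumes "Card_order \<tau>" "natLeq \<le>o \<tau>"
  shows "openin (C_space \<tau> X Y) G \<longleftrightarrow> openin_C \<tau> X Y G"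
  unfolding C_space_def topology_inverse'[OF istopology_openin_C[OF assms]] ..

lemma topspace_C_space:
  fixes X :: "'a topology" and Y :: "'b topology"
  assumes "Card_order \<tau>" "natLeq \<le>o \<tau>"
  shows "topspace (C_space \<tau> X Y) = cmaps X Y"
proof (rule antisym)
  show "topspace (C_space \<tau> X Y) \<subseteq> cmaps X Y"
    using openin_C_space[OF assms] openin_topspace unfolding openin_C_def by blast
  have "infinite (Field \<tau>)"
    by (rule infinite_Field_cardinal[OF assms])
  moreover have "Well_order \<tau>"
    using assms(1) by (simp only: card_order_on_def)
  ultimately have "|{} :: 'b set set set| <o \<tau>"
    by (intro finite_ordLess_infinite card_of_Well_order) (simp_all add: Field_card_of)
  then have "openin_C \<tau> X Y (cmaps X Y)"
    unfolding openin_C_def by (intro conjI ballI exI[of _ "{}"]) auto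
  then show "cmaps X Y \<subseteq> topspace (C_space \<tau> X Y)"
    using openin_C_space[OF assms] openin_subset by blast
qed

end

theory Submission
  imports Defs
begin

text \<open>
Compactness of the cube turns the topology of \<open>C_space\<close> into a statement about coordinates. An open cover
of the cube is refined by boxes that restrict one fixed finite set of coordinates
(\<open>tychonov_cube_Lebesgue\<close>), so every neighbourhood of a map \<open>g\<close> contains all maps that agree with \<open>g\<close>
on a suitable set of fewer than \<open>\<tau>\<close> coordinates (\<open>C_space_open_contains_agreeing\<close>). In the other direction,
closeness with respect to fewer than \<open>\<tau>\<close> countable covers can force equality on fewer than \<open>\<tau>\<close>
coordinates when \<open>\<tau>\<close> is uncountable, and can force uniform closeness on finitely many coordinates in
every case. A \<open>Z\<close>-set therefore comes with self-maps of the cube that miss it and move the prescribed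
coordinates not at all (\<open>Z_set_exact_move\<close>) or by little (\<open>Z_set_approx_move\<close>).

The embedding \<open>h\<close> is built in \<open>\<tau>\<close> steps from a list of pairs \<open>(P k, Q k)\<close> of disjoint closed sets that miss
\<open>Y\<close>. Step \<open>k\<close> composes the current map with such a self-map over \<open>P k \<union> Q k\<close>, which takes these points off
\<open>Z\<close>, and spends a fresh coordinate \<open>e k\<close> on sending \<open>P k\<close> to \<open>0\<close> and \<open>Q k\<close> to \<open>1\<close>; Urysohn functions leave
the map alone on \<open>Y\<close> (\<open>push_off_step\<close>). Whether the image is off \<open>Z\<close> is decided by finitely many coordinates.
For uncountable \<open>\<tau>\<close> each step thus fixes finitely many new coordinates forever, fewer than \<open>\<tau>\<close> are in use at
any stage, and the steps can be carried out transfinitely. For \<open>\<tau> = \<omega>\<close> old coordinates do have to move, but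
each step leaves a positive margin, the later moves are smaller than that margin, and the uniform limit
keeps what was achieved.

Let the pairs be the closures of the pairs of basic open sets, every pair repeated \<open>\<tau>\<close> times. Points off \<open>Y\<close>
are then taken off \<open>Z\<close> and separated from each other, so \<open>h\<close> is an embedding. Its image is a \<open>Z\<close>-set because
a map that misses \<open>Z\<close> can be pushed off the rest of the image as well: the part of the image in question
comes from a compact set disjoint from \<open>Y\<close>, finitely many sets \<open>P k\<close> cover it, and for each of them there
is a coordinate \<open>e k\<close>, outside any prescribed set of fewer than \<open>\<tau>\<close> coordinates, in which \<open>h\<close> stays below \<open>1\<close>;
setting these coordinates of the map to \<open>1\<close> is enough (\<open>Z_set_image_criterion\<close>).
\<close>

section \<open>The Tychonov cube\<close>

lemma topspace_tychonov_cube: "topspace (tychonov_cube T) = (\<Pi>\<^sub>E t\<in>T. {0..1})"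
  by (simp add: tychonov_cube_def)

lemma compact_space_tychonov_cube: "compact_space (tychonov_cube T)"
  unfolding tychonov_cube_def compact_space_product_topology
  by (auto simp: compact_space_subtopology)

lemma Hausdorff_space_tychonov_cube: "Hausdorff_space (tychonov_cube T)"
  by (simp add: tychonov_cube_def Hausdorff_space_product_topology Hausdorff_space_subtopology)

lemma continuous_map_tychonov_cube:
  "continuous_map X (tychonov_cube T) h \<longleftrightarrow>
     (\<forall>x\<in>topspace X. h x \<in> extensional T) \<and>
     (\<forall>t\<in>T. continuous_map X euclideanreal (\<lambda>x. h x t) \<and> (\<forall>x\<in>topspace X. h x t \<in> {0..1}))"
  unfolding tychonov_cube_def continuous_map_componentwise continuous_map_in_subtopology
  by (auto simp: image_subset_iff Pi_iff)

lemma continuous_map_coordinate: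
  "t \<in> T \<Longrightarrow> continuous_map (tychonov_cube T) euclideanreal (\<lambda>z. z t)"
  using continuous_map_tychonov_cube[of "tychonov_cube T" T "\<lambda>z. z"] by simp

lemma in_tychonov_cubeD:
  "z \<in> topspace (tychonov_cube T) \<Longrightarrow> t \<in> T \<Longrightarrow> 0 \<le> z t \<and> z t \<le> 1"
  by (auto simp: topspace_tychonov_cube PiE_iff)

lemma openin_tychonov_cube_box:
  assumes "finite F" "F \<subseteq> T"
  shows "openin (tychonov_cube T) {y \<in> topspace (tychonov_cube T). \<forall>t\<in>F. \<bar>y t - p t\<bar> < \<eta>}"
  using assms
proof (induction F)
  case empty
  then show ?case by simp
next
  case (insert t F)
  have "continuous_map (tychonov_cube T) euclideanreal (\<lambda>z. \<bar>z t - p t\<bar>)"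
    using insert.prems by (intro continuous_intros continuous_map_coordinate) auto
  then have "openin (tychonov_cube T) {y \<in> topspace (tychonov_cube T). \<bar>y t - p t\<bar> \<in> {..<\<eta>}}"
    by (rule openin_continuous_map_preimage) auto
  then have "openin (tychonov_cube T) ({y \<in> topspace (tychonov_cube T). \<bar>y t - p t\<bar> \<in> {..<\<eta>}} \<inter>
     {y \<in> topspace (tychonov_cube T). \<forall>t\<in>F. \<bar>y t - p t\<bar> < \<eta>})"
    using insert by auto
  then show ?case
    by (rule back_subst[where P="openin _"]) auto
qed

lemma tychonov_cube_open_contains_box:
  assumes U: "openin (tychonov_cube T) U" and p: "p \<in> U"
  obtains F \<eta> where "finite F" "F \<subseteq> T" "\<eta> > 0"
    "\<forall>y\<in>topspace (tychonov_cube T). (\<forall>t\<in>F. \<bar>y t - p t\<bar> < \<eta>) \<longrightarrow> y \<in> U"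
proof -
  obtain V where V: "finite {i \<in> T. V i \<noteq> {0..1::real}}"
      "\<And>i. i \<in> T \<Longrightarrow> openin (top_of_set {0..1}) (V i)" "p \<in> Pi\<^sub>E T V" "Pi\<^sub>E T V \<subseteq> U"
  proof -
    have "\<exists>V. finite {i \<in> T. V i \<noteq> topspace (top_of_set {0..1::real})} \<and>
        (\<forall>i\<in>T. openin (top_of_set {0..1}) (V i)) \<and> p \<in> Pi\<^sub>E T V \<and> Pi\<^sub>E T V \<subseteq> U"
      using U p unfolding tychonov_cube_def openin_product_topology_alt by blast
    then show thesis using that by (elim exE conjE) simp
  qed
  define F where "F = {i \<in> T. V i \<noteq> {0..1::real}}"
  have "\<exists>e>0. \<forall>y\<in>{0..1}. \<bar>y - p i\<bar> < e \<longrightarrow> y \<in> V i" if "i \<in> F" for i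
  proof -
    have "i \<in> T" using that F_def by auto
    then have "p i \<in> V i" "openin (top_of_set {0..1}) (V i)" using V by auto
    then show ?thesis
      unfolding openin_euclidean_subtopology_iff by (auto simp: dist_real_def)
  qed
  then obtain e where e: "\<And>i. i \<in> F \<Longrightarrow> e i > 0"
      "\<And>i y. i \<in> F \<Longrightarrow> y \<in> {0..1} \<Longrightarrow> \<bar>y - p i\<bar> < e i \<Longrightarrow> y \<in> V i"
    by metis
  define \<eta> where "\<eta> = Min (insert 1 (e ` F))"
  have fin: "finite F" using V(1) F_def by simp
  have le: "\<eta> \<le> e i" if "i \<in> F" for i
    unfolding \<eta>_def using that fin by (intro Min_le) auto
  show thesis
  proof
    show "finite F" "F \<subseteq> T" using fin F_def by auto
    show "\<eta> > 0" unfolding \<eta>_def using fin e(1) by auto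
    show "\<forall>y\<in>topspace (tychonov_cube T). (\<forall>t\<in>F. \<bar>y t - p t\<bar> < \<eta>) \<longrightarrow> y \<in> U"
    proof (intro ballI impI)
      fix y assume y: "y \<in> topspace (tychonov_cube T)" "\<forall>t\<in>F. \<bar>y t - p t\<bar> < \<eta>"
      have "y i \<in> V i" if "i \<in> T" for i
      proof (cases "i \<in> F")
        case True
        then show ?thesis using e(2)[OF True, of "y i"] y le[OF True] that in_tychonov_cubeD[OF y(1) that]
          by (smt (verit) atLeastAtMost_iff)
      next
        case False
        then show ?thesis using in_tychonov_cubeD[OF y(1) that] that F_def by auto
      qed
      moreover have "y \<in> extensional T" using y(1) by (auto simp: topspace_tychonov_cube PiE_iff)
      ultimately have "y \<in> Pi\<^sub>E T V" by (auto simp: PiE_iff)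
      then show "y \<in> U" using V(4) by blast
    qed
  qed
qed

text \<open>The Lebesgue number lemma for a product: boxes of half the size around the points of \<open>K\<close> have a finite
subcover, and the coordinates restricted by the finitely many boxes serve all points of \<open>K\<close> at once.\<close>
lemma tychonov_cube_Lebesgue:
  assumes K: "compactin (tychonov_cube T) K" and op: "\<And>U. U \<in> \<U> \<Longrightarrow> openin (tychonov_cube T) U"
    and cov: "K \<subseteq> \<Union>\<U>"
  obtains F \<eta> where "finite F" "F \<subseteq> T" "\<eta> > 0"
    "\<forall>z\<in>K. \<exists>U\<in>\<U>. \<forall>y\<in>topspace (tychonov_cube T). (\<forall>t\<in>F. \<bar>y t - z t\<bar> \<le> \<eta>) \<longrightarrow> y \<in> U"
proof -
  let ?I = "tychonov_cube T"
  define R where "R p q \<longleftrightarrow> (case q of (U, F, \<eta>) \<Rightarrow> U \<in> \<U> \<and> finite F \<and> F \<subseteq> T \<and> \<eta> > (0::real) \<and>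
      (\<forall>y\<in>topspace ?I. (\<forall>t\<in>F. \<bar>y t - p t\<bar> < \<eta>) \<longrightarrow> y \<in> U))" for p q
  have "\<exists>q. R p q" if p: "p \<in> K" for p
  proof -
    obtain U where U: "U \<in> \<U>" "p \<in> U" using cov p by blast
    obtain F \<eta> where "finite F" "F \<subseteq> T" "\<eta> > 0"
      "\<forall>y\<in>topspace ?I. (\<forall>t\<in>F. \<bar>y t - p t\<bar> < \<eta>) \<longrightarrow> y \<in> U"
      by (rule tychonov_cube_open_contains_box[OF op[OF U(1)] U(2)])
    then have "R p (U, F, \<eta>)" unfolding R_def using U(1) by simp
    then show ?thesis ..
  qed
  then obtain w where w: "\<And>p. p \<in> K \<Longrightarrow> R p (w p)" by metis
  define U F \<eta> where UF: "U p = fst (w p)" "F p = fst (snd (w p))" "\<eta> p = snd (snd (w p))" for p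
  have *: "\<And>p. p \<in> K \<Longrightarrow> U p \<in> \<U>" "\<And>p. p \<in> K \<Longrightarrow> finite (F p)"
      "\<And>p. p \<in> K \<Longrightarrow> F p \<subseteq> T" "\<And>p. p \<in> K \<Longrightarrow> \<eta> p > 0"
      "\<And>p y. p \<in> K \<Longrightarrow> y \<in> topspace ?I \<Longrightarrow> (\<forall>t\<in>F p. \<bar>y t - p t\<bar> < \<eta> p) \<Longrightarrow> y \<in> U p"
  proof -
    have "R p (U p, F p, \<eta> p)" if "p \<in> K" for p
      using w[OF that] unfolding UF by simp
    then show "\<And>p. p \<in> K \<Longrightarrow> U p \<in> \<U>" "\<And>p. p \<in> K \<Longrightarrow> finite (F p)"
      "\<And>p. p \<in> K \<Longrightarrow> F p \<subseteq> T" "\<And>p. p \<in> K \<Longrightarrow> \<eta> p > 0"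
      "\<And>p y. p \<in> K \<Longrightarrow> y \<in> topspace ?I \<Longrightarrow> (\<forall>t\<in>F p. \<bar>y t - p t\<bar> < \<eta> p) \<Longrightarrow> y \<in> U p"
      unfolding R_def by simp_all
  qed
  define N where "N p = {y \<in> topspace ?I. \<forall>t\<in>F p. \<bar>y t - p t\<bar> < \<eta> p / 2}" for p
  have openN: "openin ?I (N p)" if "p \<in> K" for p
    unfolding N_def by (rule openin_tychonov_cube_box[OF *(2,3)[OF that]])
  have Ksub: "K \<subseteq> topspace ?I" using K by (rule compactin_subset_topspace)
  have "p \<in> N p" if "p \<in> K" for p
    using Ksub *(4)[OF that] that by (auto simp: N_def)
  then have "K \<subseteq> \<Union>(N ` K)" by blast
  then obtain \<F> where \<F>: "finite \<F>" "\<F> \<subseteq> N ` K" "K \<subseteq> \<Union>\<F>"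
    using compactinD[OF K, of "N ` K"] openN by blast
  obtain K0 where K0: "K0 \<subseteq> K" "finite K0" "\<F> = N ` K0"
    using finite_subset_image[OF \<F>(1,2)] by blast
  note K0 = K0(2,1) \<F>(3)[unfolded K0(3)]
  define \<epsilon> where "\<epsilon> = Min (insert 1 ((\<lambda>p. \<eta> p / 2) ` K0))"
  have le: "\<epsilon> \<le> \<eta> p / 2" if "p \<in> K0" for p
    unfolding \<epsilon>_def using that K0(1) by (intro Min_le) auto
  show thesis
  proof
    show "finite (\<Union>(F ` K0))" using *(2) K0(1,2) by blast
    show "\<Union>(F ` K0) \<subseteq> T" using *(3) K0(2) by blast
    have "\<eta> p / 2 > 0" if "p \<in> K0" for p using *(4)[of p] K0(2) that by auto
    then show "\<epsilon> > 0" unfolding \<epsilon>_def using K0(1) by auto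
    show "\<forall>z\<in>K. \<exists>U\<in>\<U>. \<forall>y\<in>topspace ?I. (\<forall>t\<in>\<Union>(F ` K0). \<bar>y t - z t\<bar> \<le> \<epsilon>) \<longrightarrow> y \<in> U"
    proof
      fix z assume "z \<in> K"
      then obtain p where p: "p \<in> K0" "z \<in> N p" using K0 by auto
      have "y \<in> U p" if y: "y \<in> topspace ?I" "\<forall>t\<in>\<Union>(F ` K0). \<bar>y t - z t\<bar> \<le> \<epsilon>" for y
      proof (rule *(5)[OF _ y(1)], goal_cases)
        case 1
        show "p \<in> K" using p K0 by auto
      next
        case 2
        show ?case
        proof
          fix t assume t: "t \<in> F p"
          then have "\<bar>z t - p t\<bar> < \<eta> p / 2" using p(2) by (simp add: N_def)
          moreover have "\<bar>y t - z t\<bar> \<le> \<epsilon>" using t p y(2) by auto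
          ultimately show "\<bar>y t - p t\<bar> < \<eta> p" using le[OF p(1)] by linarith
        qed
      qed
      then show "\<exists>U\<in>\<U>. \<forall>y\<in>topspace ?I. (\<forall>t\<in>\<Union>(F ` K0). \<bar>y t - z t\<bar> \<le> \<epsilon>) \<longrightarrow> y \<in> U"
        using *(1) p(1) K0(2) by blast
    qed
  qed
qed

text \<open>Disjointness from \<open>Z\<close> is witnessed by finitely many coordinates with a positive margin. The finiteness is
what keeps the transfinite construction going, the margin is what survives a limit.\<close>
lemma tychonov_cube_compact_apart:
  assumes "compactin (tychonov_cube T) K" "closedin (tychonov_cube T) Z" "K \<inter> Z = {}"
  obtains F \<eta> where "finite F" "F \<subseteq> T" "\<eta> > 0"
    "\<forall>z\<in>K. \<forall>y\<in>Z. \<exists>t\<in>F. \<eta> < \<bar>y t - z t\<bar>"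
proof -
  let ?I = "tychonov_cube T"
  have U: "\<And>U. U \<in> {topspace ?I - Z} \<Longrightarrow> openin ?I U" using assms(2) by auto
  have cov: "K \<subseteq> \<Union>{topspace ?I - Z}" using assms(3) compactin_subset_topspace[OF assms(1)] by auto
  obtain F \<eta> where F: "finite F" "F \<subseteq> T" "\<eta> > 0"
    "\<forall>z\<in>K. \<exists>U\<in>{topspace ?I - Z}. \<forall>y\<in>topspace ?I. (\<forall>t\<in>F. \<bar>y t - z t\<bar> \<le> \<eta>) \<longrightarrow> y \<in> U"
    by (rule tychonov_cube_Lebesgue[OF assms(1) U cov])
  have "Z \<subseteq> topspace ?I" using assms(2) by (rule closedin_subset)
  have "\<exists>t\<in>F. \<eta> < \<bar>y t - z t\<bar>" if zy: "z \<in> K" "y \<in> Z" for z y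
  proof (rule ccontr)
    assume "\<not> ?thesis"
    then have "\<forall>t\<in>F. \<bar>y t - z t\<bar> \<le> \<eta>" by (simp add: not_less)
    then show False using bspec[OF F(4) zy(1)] zy(2) \<open>Z \<subseteq> topspace ?I\<close> by blast
  qed
  then have "\<forall>z\<in>K. \<forall>y\<in>Z. \<exists>t\<in>F. \<eta> < \<bar>y t - z t\<bar>" by blast
  with F show thesis by (intro that[of F \<eta>])
qed

section \<open>Neighbourhoods in the function space\<close>

lemma finite_ordLess_infinite_card:
  assumes "Card_order \<tau>" "natLeq \<le>o \<tau>" "finite S"
  shows "|S| <o \<tau>"
proof -
  have "Well_order \<tau>"
    using assms(1) by (simp only: card_order_on_def)
  then show ?thesis using infinite_Field_cardinal[OF assms(1,2)] assms(3)
    by (intro finite_ordLess_infinite card_of_Well_order) (simp_all add: Field_card_of)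
qed

text \<open>A union of infinitely many finite sets has at most as many elements as there are sets.\<close>
lemma card_of_UN_finite_ordLess:
  assumes "Card_order \<tau>" "natLeq \<le>o \<tau>" "|S| <o \<tau>" "\<And>s. s \<in> S \<Longrightarrow> finite (B s)"
  shows "|\<Union>(B ` S)| <o \<tau>"
proof (cases "finite S")
  case True
  then show ?thesis using assms by (intro finite_ordLess_infinite_card) auto
next
  case False
  have "|\<Union>(B ` S)| \<le>o |S|"
  proof (rule card_of_UNION_ordLeq_infinite[OF False])
    show "|S| \<le>o |S|" by (rule ordLeq_refl[OF card_of_Card_order])
    show "\<forall>i\<in>S. |B i| \<le>o |S|"
    proof
      fix i assume "i \<in> S"
      then have "|B i| <o |S|" using assms(4) False
        by (intro finite_ordLess_infinite card_of_Well_order) (simp_all add: Field_card_of)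
      then show "|B i| \<le>o |S|" by (rule ordLess_imp_ordLeq)
    qed
  qed
  then show ?thesis using assms(3) by (rule ordLeq_ordLess_trans)
qed

text \<open>Each of the fewer than \<open>\<tau>\<close> covers that describe the neighbourhood is refined by boxes over finitely many
coordinates, and maps that agree on these coordinates lie in the same boxes.\<close>
lemma C_space_open_contains_agreeing:
  assumes \<tau>: "Card_order \<tau>" "natLeq \<le>o \<tau>"
    and G: "openin_C \<tau> X (tychonov_cube T) G" and g: "g \<in> G"
  obtains A where "A \<subseteq> T" "|A| <o \<tau>"
    "\<forall>g'\<in>cmaps X (tychonov_cube T). (\<forall>x\<in>topspace X. \<forall>t\<in>A. g' x t = g x t) \<longrightarrow> g' \<in> G"
proof -
  let ?I = "tychonov_cube T"
  obtain \<S> where S: "\<S> \<subseteq> cov ?I" "|\<S>| <o \<tau>"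
    "\<forall>g'\<in>cmaps X ?I. (\<forall>\<U>\<in>\<S>. close_maps X \<U> g' g) \<longrightarrow> g' \<in> G"
    using G g unfolding openin_C_def by blast
  have gX: "g x \<in> topspace ?I" if "x \<in> topspace X" for x
    using G g that unfolding openin_C_def cmaps_def continuous_map_def by blast
  have "\<exists>F. finite F \<and> F \<subseteq> T \<and> (\<forall>z\<in>topspace ?I. \<exists>U\<in>\<U>. \<forall>y\<in>topspace ?I.
      (\<forall>t\<in>F. y t = z t) \<longrightarrow> y \<in> U)" if U: "\<U> \<in> \<S>" for \<U>
  proof -
    have op: "openin ?I U" if "U \<in> \<U>" for U
    proof -
      have "functionally_open_in ?I U" using that U S(1) by (auto simp: cov_def)
      then obtain \<phi> where \<phi>: "continuous_map ?I euclideanreal \<phi>" "U = {y \<in> topspace ?I. \<phi> y \<in> -{0}}"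
        unfolding functionally_open_in_def by auto
      show ?thesis unfolding \<phi>(2) by (rule openin_continuous_map_preimage[OF \<phi>(1)]) auto
    qed
    have cov: "topspace ?I \<subseteq> \<Union>\<U>" using U S(1) by (auto simp: cov_def)
    obtain F \<eta> where F: "finite F" "F \<subseteq> T" "\<eta> > (0::real)"
      "\<forall>z\<in>topspace ?I.
         \<exists>U\<in>\<U>. \<forall>y\<in>topspace ?I. (\<forall>t\<in>F. \<bar>y t - z t\<bar> \<le> \<eta>) \<longrightarrow> y \<in> U"
      by (rule tychonov_cube_Lebesgue[OF compact_space_tychonov_cube[unfolded compact_space_def] op cov])
    have "\<exists>U\<in>\<U>. \<forall>y\<in>topspace ?I. (\<forall>t\<in>F. y t = z t) \<longrightarrow> y \<in> U" if z: "z \<in> topspace ?I" for z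
      using bspec[OF F(4) z] F(3) by fastforce
    with F(1,2) show ?thesis by blast
  qed
  then obtain F where F': "\<forall>\<U>\<in>\<S>. finite (F \<U>) \<and> F \<U> \<subseteq> T \<and> (\<forall>z\<in>topspace ?I. \<exists>U\<in>\<U>. \<forall>y\<in>topspace ?I.
      (\<forall>t\<in>F \<U>. y t = z t) \<longrightarrow> y \<in> U)"
    by metis
  then have F: "\<And>\<U>. \<U> \<in> \<S> \<Longrightarrow> finite (F \<U>)" "\<And>\<U>. \<U> \<in> \<S> \<Longrightarrow> F \<U> \<subseteq> T"
    "\<And>\<U> z. \<U> \<in> \<S> \<Longrightarrow> z \<in> topspace ?I \<Longrightarrow>
       \<exists>U\<in>\<U>. \<forall>y\<in>topspace ?I. (\<forall>t\<in>F \<U>. y t = z t) \<longrightarrow> y \<in> U"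
    by blast+
  show thesis
  proof
    show "\<Union>(F ` \<S>) \<subseteq> T" using F(2) by blast
    show "|\<Union>(F ` \<S>)| <o \<tau>" by (rule card_of_UN_finite_ordLess[OF \<tau> S(2) F(1)])
    show "\<forall>g'\<in>cmaps X ?I. (\<forall>x\<in>topspace X. \<forall>t\<in>\<Union>(F ` \<S>). g' x t = g x t) \<longrightarrow> g' \<in> G"
    proof (intro ballI impI)
      fix g' assume g': "g' \<in> cmaps X ?I"
        "\<forall>x\<in>topspace X. \<forall>t\<in>\<Union>(F ` \<S>). g' x t = g x t"
      have "close_maps X \<U> g' g" if "\<U> \<in> \<S>" for \<U>
        unfolding close_maps_def
      proof
        fix x assume x: "x \<in> topspace X"
        have "g' x \<in> topspace ?I" using g'(1) x unfolding cmaps_def continuous_map_def by blast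
        moreover have "\<forall>t\<in>F \<U>. g' x t = g x t" using that x g'(2) by blast
        ultimately show "\<exists>U\<in>\<U>. g' x \<in> U \<and> g x \<in> U"
          using F(3)[OF that gX[OF x]] gX[OF x] by blast
      qed
      then show "g' \<in> G" using S(3) g'(1) by blast
    qed
  qed
qed

lemma Z_set_in_dense:
  fixes X :: "'a topology" and \<tau> :: "'k rel"
  assumes \<tau>: "Card_order \<tau>" "natLeq \<le>o \<tau>" and Z: "Z_set_in \<tau> X Z"
    and G: "openin_C \<tau> X X G" "g \<in> G"
  obtains g' where "g' \<in> G" "g' ` topspace X \<inter> Z = {}"
proof -
  have "g \<in> cmaps X X" using G unfolding openin_C_def by blast
  moreover have "C_space \<tau> X X closure_of {f \<in> cmaps X X. f ` topspace X \<inter> Z = {}} = cmaps X X"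
    using Z unfolding Z_set_in_def topspace_C_space[OF \<tau>] by simp
  ultimately have "g \<in> C_space \<tau> X X closure_of {f \<in> cmaps X X. f ` topspace X \<inter> Z = {}}"
    by simp
  moreover have "openin (C_space \<tau> X X) G" by (rule iffD2[OF openin_C_space[OF \<tau>] G(1)])
  ultimately have "\<exists>g'. g' \<in> {f \<in> cmaps X X. f ` topspace X \<inter> Z = {}} \<and> g' \<in> G"
    using G(2) by (simp only: in_closure_of)
  then show thesis using that by (elim exE conjE) simp
qed

text \<open>The cover of the cube by all slabs of half-width \<open>r\<close> transverse to the coordinate \<open>a\<close>; closeness with respect
to it controls that coordinate up to \<open>2 * r\<close>. Rational centres make the cover countable.\<close>
definition slabs :: "'i set \<Rightarrow> 'i \<Rightarrow> real \<Rightarrow> ('i \<Rightarrow> real) set set" where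
  "slabs T a r = (\<lambda>q. {z \<in> topspace (tychonov_cube T). \<bar>z a - q\<bar> < r}) ` \<rat>"

lemma slabs_in_cov:
  assumes "a \<in> T" "r > 0"
  shows "slabs T a r \<in> cov (tychonov_cube T)"
proof -
  let ?I = "tychonov_cube T"
  have "functionally_open_in ?I {z \<in> topspace ?I. \<bar>z a - q\<bar> < r}" for q
    unfolding functionally_open_in_def
  proof (intro exI conjI)
    show "continuous_map ?I euclideanreal (\<lambda>z. max 0 (r - \<bar>z a - q\<bar>))"
      using assms by (intro continuous_intros continuous_map_coordinate)
    show "{z \<in> topspace ?I. \<bar>z a - q\<bar> < r} = {z \<in> topspace ?I. max 0 (r - \<bar>z a - q\<bar>) \<noteq> 0}"
      by (auto simp: max_def)
  qed
  then have "\<forall>U\<in>slabs T a r. functionally_open_in ?I U" unfolding slabs_def by simp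
  moreover have "countable (slabs T a r)" unfolding slabs_def by (simp add: countable_rat)
  moreover have "\<Union>(slabs T a r) = topspace ?I"
  proof (intro equalityI subsetI)
    fix z assume z: "z \<in> topspace ?I"
    obtain q where "q \<in> \<rat>" "z a < q" "q < z a + r"
      using Rats_dense_in_real[of "z a" "z a + r"] assms by auto
    then have "z \<in> {z \<in> topspace ?I. \<bar>z a - q\<bar> < r}" using z by simp
    then show "z \<in> \<Union>(slabs T a r)" using \<open>q \<in> \<rat>\<close> unfolding slabs_def by (intro UN_I)
  qed (simp add: slabs_def)
  ultimately show ?thesis unfolding cov_def by simp
qed

lemma close_maps_slabs:
  assumes "close_maps X (slabs T a r) g h" "x \<in> topspace X"
  shows "\<bar>g x a - h x a\<bar> < 2 * r"
proof -
  obtain U where "U \<in> slabs T a r" "g x \<in> U" "h x \<in> U"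
    using assms unfolding close_maps_def by blast
  then obtain q where "\<bar>g x a - q\<bar> < r" "\<bar>h x a - q\<bar> < r" unfolding slabs_def by blast
  then show ?thesis by linarith
qed

lemma restrict_in_cmaps:
  assumes "continuous_map X Y f"
  shows "restrict f (topspace X) \<in> cmaps X Y"
proof -
  have "continuous_map X Y (restrict f (topspace X))"
    by (rule continuous_map_eq[OF assms]) simp
  then show ?thesis unfolding cmaps_def by simp
qed

text \<open>The set of maps to which density is applied asks for a bound strictly below \<open>\<epsilon>\<close> that is uniform in the point;
the room between that bound and \<open>\<epsilon>\<close> is what makes the set open.\<close>
lemma Z_set_approx_move:
  assumes \<tau>: "Card_order \<tau>" "natLeq \<le>o \<tau>" and Z: "Z_set_in \<tau> (tychonov_cube T) Z"
    and A: "finite A" "A \<subseteq> T" and \<epsilon>: "\<epsilon> > 0"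
  obtains g where "continuous_map (tychonov_cube T) (tychonov_cube T) g"
    "\<forall>z\<in>topspace (tychonov_cube T). \<forall>a\<in>A. \<bar>g z a - z a\<bar> < \<epsilon>"
    "g ` topspace (tychonov_cube T) \<inter> Z = {}"
proof -
  let ?I = "tychonov_cube T"
  define G where "G = {g \<in> cmaps ?I ?I. \<exists>r<\<epsilon>. \<forall>a\<in>A. \<forall>z\<in>topspace ?I. \<bar>g z a - z a\<bar> \<le> r}"
  have "openin_C \<tau> ?I ?I G"
    unfolding openin_C_def
  proof (intro conjI ballI)
    show "G \<subseteq> cmaps ?I ?I" unfolding G_def by auto
    fix h assume "h \<in> G"
    then obtain r where r: "r < \<epsilon>" "\<forall>a\<in>A. \<forall>z\<in>topspace ?I. \<bar>h z a - z a\<bar> \<le> r"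
      unfolding G_def by blast
    let ?r = "(\<epsilon> - r) / 4"
    show "\<exists>\<S>\<subseteq>cov ?I. |\<S>| <o \<tau> \<and> (\<forall>g\<in>cmaps ?I ?I. (\<forall>\<U>\<in>\<S>. close_maps ?I \<U> g h) \<longrightarrow> g \<in> G)"
    proof (intro exI[of _ "(\<lambda>a. slabs T a ?r) ` A"] conjI ballI impI)
      show "(\<lambda>a. slabs T a ?r) ` A \<subseteq> cov ?I" using A r slabs_in_cov[of _ T ?r] by auto
      show "|(\<lambda>a. slabs T a ?r) ` A| <o \<tau>" using A by (intro finite_ordLess_infinite_card[OF \<tau>]) auto
      fix g assume g: "g \<in> cmaps ?I ?I" "\<forall>\<U>\<in>(\<lambda>a. slabs T a ?r) ` A. close_maps ?I \<U> g h"
      have "\<bar>g z a - z a\<bar> \<le> r + 2 * ?r" if "a \<in> A" "z \<in> topspace ?I" for a z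
      proof -
        have "close_maps ?I (slabs T a ?r) g h" using g(2) that(1) by blast
        from close_maps_slabs[OF this that(2)] bspec[OF bspec[OF r(2) that(1)] that(2)] show ?thesis by linarith
      qed
      moreover have "r + 2 * ?r < \<epsilon>" using r(1) by (simp add: field_simps)
      ultimately show "g \<in> G" using g(1) unfolding G_def by blast
    qed
  qed
  moreover have "restrict (\<lambda>z. z) (topspace ?I) \<in> G"
    unfolding G_def
  proof (intro CollectI conjI exI[of _ 0])
    show "restrict (\<lambda>z. z) (topspace ?I) \<in> cmaps ?I ?I" by (rule restrict_in_cmaps) simp
  qed (use \<epsilon> in simp_all)
  ultimately obtain g where g: "g \<in> G" "g ` topspace ?I \<inter> Z = {}"
    by (rule Z_set_in_dense[OF \<tau> Z])
  have "continuous_map ?I ?I g" using g(1) by (simp add: G_def cmaps_def)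
  moreover have "\<forall>z\<in>topspace ?I. \<forall>a\<in>A. \<bar>g z a - z a\<bar> < \<epsilon>" 
  proof (intro ballI)
    fix z a assume *: "z \<in> topspace ?I" "a \<in> A"
    obtain r where "r < \<epsilon>" "\<forall>a\<in>A. \<forall>z\<in>topspace ?I. \<bar>g z a - z a\<bar> \<le> r"
      using g(1) unfolding G_def by blast
    then show "\<bar>g z a - z a\<bar> < \<epsilon>" using * by (meson order_le_less_trans)
  qed
  ultimately show thesis using g(2) by (rule that)
qed

text \<open>For uncountable \<open>\<tau>\<close> the maps that fix the coordinates in \<open>A\<close> form an open set: the slabs of all half-widths
\<open>1 / (n + 1)\<close> over all \<open>a \<in> A\<close> are still fewer than \<open>\<tau>\<close> covers, and together they force equality.\<close>
lemma Z_set_exact_move: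
  fixes T :: "'i set"
  assumes \<tau>: "Card_order \<tau>" "natLeq <o \<tau>" and Z: "Z_set_in \<tau> (tychonov_cube T) Z"
    and A: "|A| <o \<tau>" "A \<subseteq> T"
  obtains g where "continuous_map (tychonov_cube T) (tychonov_cube T) g"
    "\<forall>z\<in>topspace (tychonov_cube T). \<forall>a\<in>A. g z a = z a"
    "g ` topspace (tychonov_cube T) \<inter> Z = {}"
proof -
  let ?I = "tychonov_cube T"
  note \<tau>' = \<tau>(1) ordLess_imp_ordLeq[OF \<tau>(2)]
  define G where "G = {g \<in> cmaps ?I ?I. \<forall>a\<in>A. \<forall>z\<in>topspace ?I. g z a = z a}"
  let ?S = "(\<lambda>(a, n). slabs T a (1 / real (Suc n))) ` (A \<times> UNIV)"
  have "|A \<times> (UNIV :: nat set)| <o \<tau>"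
  proof (cases "finite A")
    case True
    then have "countable (A \<times> (UNIV :: nat set))" by (intro countable_SIGMA) (auto simp: countable_finite)
    then obtain f :: "'i \<times> nat \<Rightarrow> nat" where "inj_on f (A \<times> UNIV)"
      unfolding countable_def by blast
    then have "|A \<times> (UNIV :: nat set)| \<le>o |UNIV :: nat set|"
      by (rule card_of_ordLeqI) simp
    then have "|A \<times> (UNIV :: nat set)| \<le>o natLeq"
      using card_of_nat by (rule ordLeq_ordIso_trans)
    then show ?thesis using \<tau>(2) by (rule ordLeq_ordLess_trans)
  next
    case False
    then have "|UNIV :: nat set| \<le>o |A|" using infinite_iff_card_of_nat by blast
    then have "|A \<times> (UNIV :: nat set)| =o |A|" using False by (intro card_of_Times_infinite_simps) auto
    then show ?thesis using A(1) by (rule ordIso_ordLess_trans)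
  qed
  then have card: "|?S| <o \<tau>" by (rule ordLeq_ordLess_trans[OF card_of_image])
  have "openin_C \<tau> ?I ?I G"
    unfolding openin_C_def
  proof (intro conjI ballI)
    show "G \<subseteq> cmaps ?I ?I" unfolding G_def by auto
    fix h assume h: "h \<in> G"
    show "\<exists>\<S>\<subseteq>cov ?I. |\<S>| <o \<tau> \<and> (\<forall>g\<in>cmaps ?I ?I. (\<forall>\<U>\<in>\<S>. close_maps ?I \<U> g h) \<longrightarrow> g \<in> G)"
    proof (intro exI[of _ ?S] conjI ballI impI)
      show "?S \<subseteq> cov ?I"
      proof clarify
        fix a n assume "a \<in> A"
        then show "slabs T a (1 / real (Suc n)) \<in> cov ?I" using A(2) by (intro slabs_in_cov) auto
      qed
      show "|?S| <o \<tau>" by (rule card)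
      fix g assume g: "g \<in> cmaps ?I ?I" "\<forall>\<U>\<in>?S. close_maps ?I \<U> g h"
      have "g z a = z a" if "a \<in> A" "z \<in> topspace ?I" for a z
      proof -
        have le: "\<bar>g z a - h z a\<bar> \<le> e" if "e > 0" for e
        proof -
          obtain n where n: "1 / real (Suc n) < e / 2" using nat_approx_posE[of "e/2"] \<open>e > 0\<close> by auto
          have "close_maps ?I (slabs T a (1 / real (Suc n))) g h"
            using g(2) \<open>a \<in> A\<close> by (intro bspec[OF g(2)] image_eqI[where x="(a, n)"]) simp_all
          from close_maps_slabs[OF this \<open>z \<in> topspace ?I\<close>] n show ?thesis by linarith
        qed
        have "\<bar>g z a - h z a\<bar> \<le> 0" by (rule field_le_epsilon) (simp add: le)
        moreover have "h z a = z a" using h that unfolding G_def by blast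
        ultimately show ?thesis by simp
      qed
      then show "g \<in> G" using g(1) unfolding G_def by blast
    qed
  qed
  moreover have "restrict (\<lambda>z. z) (topspace ?I) \<in> G"
    unfolding G_def using restrict_in_cmaps[OF continuous_map_id[unfolded id_def], of ?I] by simp
  ultimately obtain g where g: "g \<in> G" "g ` topspace ?I \<inter> Z = {}"
    by (rule Z_set_in_dense[OF \<tau>' Z])
  have "continuous_map ?I ?I g" using g(1) by (simp add: G_def cmaps_def)
  moreover have "\<forall>z\<in>topspace ?I. \<forall>a\<in>A. g z a = z a" using g(1) unfolding G_def by blast
  ultimately show thesis using g(2) by (rule that)
qed

section \<open>When an image is a Z-set\<close>

text \<open>To push a map off \<open>h ` topspace X\<close>, first push it off \<open>Z\<close>. This is witnessed by a finite set \<open>F\<close> of coordinates,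
and as long as these are kept no point of \<open>h ` V\<close> can be hit for some open \<open>V\<close> containing \<open>Y\<close>. The complement
of \<open>V\<close> is compact, so that by \<open>free\<close> finitely many coordinates, outside \<open>F\<close> and outside the coordinates that
determine the given neighbourhood, can be set to \<open>1\<close> to avoid the remaining points.\<close>
lemma Z_set_image_criterion:
  fixes T :: "'i set" and \<tau> :: "'k rel" and h :: "'a \<Rightarrow> 'i \<Rightarrow> real"
  assumes \<tau>: "Card_order \<tau>" "natLeq \<le>o \<tau>" and Z: "Z_set_in \<tau> (tychonov_cube T) Z"
    and X: "compact_space X" and Y: "closedin X Y"
    and h: "continuous_map X (tychonov_cube T) h" and hY: "h ` Y \<subseteq> Z"
    and free: "\<And>x A. x \<in> topspace X - Y \<Longrightarrow> |A| <o \<tau> \<Longrightarrow>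
      \<exists>U t. openin X U \<and> x \<in> U \<and> t \<in> T - A \<and> (\<forall>x'\<in>U. h x' t \<noteq> 1)"
  shows "Z_set_in \<tau> (tychonov_cube T) (h ` topspace X)"
proof -
  let ?I = "tychonov_cube T"
  have Zcl: "closedin ?I Z" using Z unfolding Z_set_in_def by blast
  have hI: "h x \<in> topspace ?I" if "x \<in> topspace X" for x
    using h that unfolding continuous_map_def by blast
  have "compactin ?I (h ` topspace X)"
    using image_compactin[OF _ h] X unfolding compact_space_def by blast
  then have cl: "closedin ?I (h ` topspace X)"
    by (rule compactin_imp_closedin[OF Hausdorff_space_tychonov_cube])
  have dense: "\<exists>g. g \<in> {f \<in> cmaps ?I ?I. f ` topspace ?I \<inter> h ` topspace X = {}} \<and> g \<in> G"
    if G: "g0 \<in> G \<and> openin_C \<tau> ?I ?I G" for G g0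
  proof -
    note G = conjunct2[OF G] conjunct1[OF G]
    obtain g1 where g1: "g1 \<in> G" "g1 ` topspace ?I \<inter> Z = {}"
      by (rule Z_set_in_dense[OF \<tau> Z G])
    have g1c: "continuous_map ?I ?I g1" using G(1) g1(1) unfolding openin_C_def cmaps_def by blast
    obtain A where A: "A \<subseteq> T" "|A| <o \<tau>"
      "\<forall>g'\<in>cmaps ?I ?I. (\<forall>x\<in>topspace ?I. \<forall>t\<in>A. g' x t = g1 x t) \<longrightarrow> g' \<in> G"
      by (rule C_space_open_contains_agreeing[OF \<tau> G(1) g1(1)])
    have K: "compactin ?I (g1 ` topspace ?I)"
      by (rule image_compactin[OF _ g1c]) (use compact_space_tychonov_cube compact_space_def in blast)
    obtain F \<eta> where F: "finite F" "F \<subseteq> T" "\<eta> > 0"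
      "\<forall>z\<in>g1 ` topspace ?I. \<forall>y\<in>Z. \<exists>t\<in>F. \<eta> < \<bar>y t - z t\<bar>"
      by (rule tychonov_cube_compact_apart[OF K Zcl g1(2)])
    \<comment> \<open>In the coordinates \<open>F\<close>, points of \<open>h ` V y\<close> are closer than \<open>\<eta>\<close> to \<open>h y \<in> Z\<close>, those of the image of \<open>g1\<close>
        are not.\<close>
    define V where "V y = {x \<in> topspace X. h x \<in> {z \<in> topspace ?I. \<forall>t\<in>F. \<bar>z t - h y t\<bar> < \<eta>}}" for y
    have "openin X (V y)" for y
      unfolding V_def by (rule openin_continuous_map_preimage[OF h openin_tychonov_cube_box[OF F(1,2)]])
    then have "openin X (\<Union>(V ` Y))" by blast
    then have "closedin X (topspace X - \<Union>(V ` Y))" by blast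
    then have D: "compactin X (topspace X - \<Union>(V ` Y))" by (rule closedin_compact_space[OF X])
    let ?D = "topspace X - \<Union>(V ` Y)"
    have YX: "Y \<subseteq> topspace X" using Y by (rule closedin_subset)
    have "y \<in> V y" if "y \<in> Y" for y
      using that YX hI F(3) unfolding V_def by auto
    then have DY: "?D \<subseteq> topspace X - Y" by blast
    have AF: "|A \<union> F| <o \<tau>"
      by (rule card_of_Un_ordLess_infinite_Field[OF infinite_Field_cardinal[OF \<tau>] \<tau>(1) A(2)
            finite_ordLess_infinite_card[OF \<tau> F(1)]])
    have "\<forall>x\<in>?D. \<exists>p. openin X (fst p) \<and> x \<in> fst p \<and> snd p \<in> T - (A \<union> F) \<and> (\<forall>x'\<in>fst p. h x' (snd p) \<noteq> 1)"
    proof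
      fix x assume "x \<in> ?D"
      then have "x \<in> topspace X - Y" using DY by blast
      from free[OF this AF] show "\<exists>p. openin X (fst p) \<and> x \<in> fst p \<and> snd p \<in> T - (A \<union> F) \<and>
          (\<forall>x'\<in>fst p. h x' (snd p) \<noteq> 1)" by simp
    qed
    then obtain p where p: "\<forall>x\<in>?D. openin X (fst (p x)) \<and> x \<in> fst (p x) \<and> snd (p x) \<in> T - (A \<union> F) \<and>
        (\<forall>x'\<in>fst (p x). h x' (snd (p x)) \<noteq> 1)"
      by (rule bchoice[THEN exE])
    have "\<exists>\<F>. finite \<F> \<and> \<F> \<subseteq> (\<lambda>x. fst (p x)) ` ?D \<and> ?D \<subseteq> \<Union>\<F>"
      by (rule compactinD[OF D]) (use p in blast)+
    then obtain \<F> where \<F>: "finite \<F>" "\<F> \<subseteq> (\<lambda>x. fst (p x)) ` ?D" "?D \<subseteq> \<Union>\<F>" by blast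
    obtain D0 where D0: "D0 \<subseteq> ?D" "finite D0" "\<F> = (\<lambda>x. fst (p x)) ` D0"
      using finite_subset_image[OF \<F>(1,2)] by blast
    define E where "E = (\<lambda>x. snd (p x)) ` D0"
    have E: "E \<subseteq> T - (A \<union> F)" using p D0(1) unfolding E_def by blast
    \<comment> \<open>\<open>E\<close> avoids both \<open>A\<close>, so that \<open>g2\<close> stays in \<open>G\<close>, and \<open>F\<close>, so that \<open>g2\<close> still misses \<open>h\<close> near \<open>Y\<close>.\<close>
    define g2 where "g2 z t = (if t \<in> E then 1 else g1 z t)" for z t
    have g1': "\<forall>x\<in>topspace ?I. g1 x \<in> extensional T"
      "\<forall>t\<in>T. continuous_map ?I euclideanreal (\<lambda>x. g1 x t) \<and> (\<forall>x\<in>topspace ?I. g1 x t \<in> {0..1})"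
      using g1c unfolding continuous_map_tychonov_cube by blast+
    have "continuous_map ?I ?I g2"
      unfolding continuous_map_tychonov_cube
    proof (intro conjI ballI)
      fix x assume "x \<in> topspace ?I"
      then show "g2 x \<in> extensional T" using g1'(1) E unfolding g2_def extensional_def by auto
    next
      fix t assume "t \<in> T"
      then show "continuous_map ?I euclideanreal (\<lambda>x. g2 x t)"
        using g1'(2) unfolding g2_def by (cases "t \<in> E") auto
    next
      fix t x assume "t \<in> T" "x \<in> topspace ?I"
      then show "g2 x t \<in> {0..1}" using g1'(2) unfolding g2_def by auto
    qed
    then have g2c: "restrict g2 (topspace ?I) \<in> cmaps ?I ?I" by (rule restrict_in_cmaps)
    moreover have "restrict g2 (topspace ?I) \<in> G"
    proof (rule A(3)[rule_format, OF g2c])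
      fix x t assume "x \<in> topspace ?I" "t \<in> A"
      then show "restrict g2 (topspace ?I) x t = g1 x t" using E unfolding g2_def by auto
    qed
    moreover have False if z: "z \<in> topspace ?I" and x: "x \<in> topspace X" and eq: "g2 z = h x" for z x
    proof (cases "x \<in> ?D")
      case True
      then obtain d where "d \<in> D0" "x \<in> fst (p d)" using \<F>(3) D0(3) by blast
      then have "h x (snd (p d)) \<noteq> 1" "snd (p d) \<in> E" using p D0(1) unfolding E_def by blast+
      then show False unfolding eq[symmetric] g2_def by simp
    next
      case False
      then obtain y where y: "y \<in> Y" "x \<in> V y" using x by blast
      have "h y \<in> Z" using hY y(1) by blast
      then obtain t where t: "t \<in> F" "\<eta> < \<bar>h y t - g1 z t\<bar>" using F(4) z by blast
      have "h x t = g1 z t" unfolding eq[symmetric] g2_def using t(1) E by auto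
      moreover have "\<bar>h x t - h y t\<bar> < \<eta>" using y(2) t(1) unfolding V_def by blast
      ultimately show False using t(2) by linarith
    qed
    then have "restrict g2 (topspace ?I) ` topspace ?I \<inter> h ` topspace X = {}" by auto
    ultimately show ?thesis by blast
  qed
  have "cmaps ?I ?I \<subseteq> C_space \<tau> ?I ?I closure_of
      {f \<in> cmaps ?I ?I. f ` topspace ?I \<inter> h ` topspace X = {}}"
  proof
    fix g0 assume "g0 \<in> cmaps ?I ?I"
    then show "g0 \<in> C_space \<tau> ?I ?I closure_of {f \<in> cmaps ?I ?I. f ` topspace ?I \<inter> h ` topspace X = {}}"
      unfolding in_closure_of topspace_C_space[OF \<tau>] openin_C_space[OF \<tau>]
      using dense by (intro conjI allI impI)
  qed
  then show ?thesis
    unfolding Z_set_in_def using cl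
      closure_of_subset_topspace[of "C_space \<tau> ?I ?I"
        "{f \<in> cmaps ?I ?I. f ` topspace ?I \<inter> h ` topspace X = {}}"]
    unfolding topspace_C_space[OF \<tau>] by (intro conjI subset_antisym)
qed

section \<open>One step of the construction\<close>

text \<open>Two Urysohn functions that vanish on \<open>Y\<close> cut \<open>w\<close> down to \<open>0\<close> on \<open>P\<close> and lift it to \<open>1\<close> on \<open>Q\<close>.\<close>
lemma Urysohn_prescribed:
  assumes X: "normal_space X" and cl: "closedin X Y" "closedin X P" "closedin X Q"
    and disj: "P \<inter> Q = {}" "(P \<union> Q) \<inter> Y = {}"
    and w: "continuous_map X euclideanreal w" "\<forall>x\<in>topspace X. w x \<in> {0..1}"
  obtains w' where "continuous_map X euclideanreal w'" "\<forall>x\<in>topspace X. w' x \<in> {0..1::real}"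
    "\<forall>y\<in>Y. w' y = w y" "\<forall>x\<in>P. w' x = 0" "\<forall>x\<in>Q. w' x = 1"
proof -
  have cl': "closedin X (Y \<union> Q)" "closedin X (Y \<union> P)" using cl by auto
  have disj': "disjnt (Y \<union> Q) P" "disjnt (Y \<union> P) Q" using disj unfolding disjnt_def by auto
  obtain p where p: "continuous_map X (top_of_set {0..1}) p" "p ` (Y \<union> Q) \<subseteq> {0::real}" "p ` P \<subseteq> {1}"
    by (rule Urysohn_lemma[OF X cl'(1) cl(2) disj'(1) zero_le_one])
  obtain q where q: "continuous_map X (top_of_set {0..1}) q" "q ` (Y \<union> P) \<subseteq> {0::real}" "q ` Q \<subseteq> {1}"
    by (rule Urysohn_lemma[OF X cl'(2) cl(3) disj'(2) zero_le_one])
  have pq: "continuous_map X euclideanreal p" "continuous_map X euclideanreal q"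
    "\<forall>x\<in>topspace X. p x \<in> {0..1}" "\<forall>x\<in>topspace X. q x \<in> {0..1}"
    using p(1) q(1) unfolding continuous_map_in_subtopology by auto
  have sub: "Y \<subseteq> topspace X" "P \<subseteq> topspace X" "Q \<subseteq> topspace X" using cl closedin_subset by blast+
  define w' where "w' x = max (min (w x) (1 - p x)) (q x)" for x
  show thesis
  proof
    show "continuous_map X euclideanreal w'"
      unfolding w'_def using w pq by (intro continuous_intros)
    show "\<forall>x\<in>topspace X. w' x \<in> {0..1}" using w(2) pq(3,4) unfolding w'_def by fastforce
    show "\<forall>y\<in>Y. w' y = w y"
    proof
      fix y assume "y \<in> Y"
      then have "p y = 0" "q y = 0" "w y \<in> {0..1}" using p(2) q(2) w(2) sub by blast+
      then show "w' y = w y" unfolding w'_def by auto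
    qed
    show "\<forall>x\<in>P. w' x = 0"
    proof
      fix y assume "y \<in> P"
      then have "p y = 1" "q y = 0" "w y \<in> {0..1}" using p(3) q(2) w(2) sub by blast+
      then show "w' y = 0" unfolding w'_def by auto
    qed
    show "\<forall>x\<in>Q. w' x = 1"
    proof
      fix y assume "y \<in> Q"
      then have "p y = 0" "q y = 1" "w y \<in> {0..1}" using p(2) q(3) w(2) sub by blast+
      then show "w' y = 1" unfolding w'_def by auto
    qed
  qed
qed

text \<open>Blend \<open>h\<close> with \<open>g \<circ> h\<close> along a Urysohn function that is \<open>0\<close> on \<open>Y\<close> and \<open>1\<close> on \<open>P \<union> Q\<close>, then redefine one coordinate
\<open>e\<close> by \<open>Urysohn_prescribed\<close>. Since \<open>e\<close> lies outside the coordinates \<open>F\<close> that certify disjointness from \<open>Z\<close>, the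
redefinition does no harm. The set \<open>A\<close> stands for the coordinates already in use. The blend moves every
coordinate other than \<open>e\<close> at most as far as \<open>g\<close> does: not at all if \<open>g\<close> fixes that coordinate.\<close>
lemma push_off_step:
  fixes T :: "'i set" and h :: "'a \<Rightarrow> 'i \<Rightarrow> real"
  assumes X: "normal_space X" and cl: "closedin X Y" "closedin X P" "closedin X Q"
    and disj: "P \<inter> Q = {}" "(P \<union> Q) \<inter> Y = {}"
    and h: "continuous_map X (tychonov_cube T) h"
    and g: "continuous_map (tychonov_cube T) (tychonov_cube T) g" "g ` topspace (tychonov_cube T) \<inter> Z = {}"
    and Z: "closedin (tychonov_cube T) Z" and A: "infinite (T - A)"
  obtains h' F \<eta> e where "continuous_map X (tychonov_cube T) h'" "\<forall>y\<in>Y. h' y = h y"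
    "finite F" "F \<subseteq> T" "\<eta> > 0" "\<forall>x\<in>P \<union> Q. \<forall>z\<in>Z. \<exists>t\<in>F. \<eta> < \<bar>z t - h' x t\<bar>"
    "e \<in> T - (A \<union> F)" "\<forall>x\<in>P. h' x e = 0" "\<forall>x\<in>Q. h' x e = 1"
    "\<forall>x\<in>topspace X. \<forall>t\<in>T - {e}. \<bar>h' x t - h x t\<bar> \<le> \<bar>g (h x) t - h x t\<bar>"
proof -
  let ?I = "tychonov_cube T"
  have K: "compactin ?I (g ` topspace ?I)"
    by (rule image_compactin[OF _ g(1)]) (use compact_space_tychonov_cube compact_space_def in blast)
  obtain F \<eta> where F: "finite F" "F \<subseteq> T" "\<eta> > 0"
      "\<forall>z\<in>g ` topspace ?I. \<forall>y\<in>Z. \<exists>t\<in>F. \<eta> < \<bar>y t - z t\<bar>"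
    by (rule tychonov_cube_compact_apart[OF K Z g(2)])
  have "infinite (T - A - F)" using A F(1) by simp
  then obtain e where e: "e \<in> T - A - F" using infinite_imp_nonempty by blast
  have gh: "continuous_map X ?I (\<lambda>x. g (h x))"
    using continuous_map_compose[OF h g(1)] by (simp add: comp_def)
  have h': "\<forall>x\<in>topspace X. h x \<in> extensional T"
      "\<forall>t\<in>T. continuous_map X euclideanreal (\<lambda>x. h x t) \<and> (\<forall>x\<in>topspace X. h x t \<in> {0..1})"
    using h unfolding continuous_map_tychonov_cube by blast+
  have gh': "\<forall>t\<in>T. continuous_map X euclideanreal (\<lambda>x. g (h x) t) \<and> (\<forall>x\<in>topspace X. g (h x) t \<in> {0..1})"
    using gh unfolding continuous_map_tychonov_cube by blast
  have sub: "Y \<subseteq> topspace X" "P \<subseteq> topspace X" "Q \<subseteq> topspace X" using cl closedin_subset by blast+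
  have PQ: "closedin X (P \<union> Q)" "disjnt Y (P \<union> Q)" using cl disj unfolding disjnt_def by auto
  obtain v where v: "continuous_map X (top_of_set {0..1}) v" "v ` Y \<subseteq> {0::real}" "v ` (P \<union> Q) \<subseteq> {1}"
    by (rule Urysohn_lemma[OF X cl(1) PQ zero_le_one])
  have v': "continuous_map X euclideanreal v" "\<forall>x\<in>topspace X. v x \<in> {0..1}"
    using v(1) unfolding continuous_map_in_subtopology by auto
  have eT: "e \<in> T" using e by blast
  obtain w where w: "continuous_map X euclideanreal w" "\<forall>x\<in>topspace X. w x \<in> {0..1::real}"
    "\<forall>y\<in>Y. w y = h y e" "\<forall>x\<in>P. w x = 0" "\<forall>x\<in>Q. w x = 1"
    by (rule Urysohn_prescribed[OF X cl disj, of "\<lambda>x. h x e"]) (use h'(2) eT in simp_all)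
  define k where "k x t = (if t = e then w x else if t \<in> T then h x t + v x * (g (h x) t - h x t) else undefined)" for x t
  show thesis
  proof (rule that[of k F \<eta> e])
    show "continuous_map X ?I k"
      unfolding continuous_map_tychonov_cube
    proof (intro conjI ballI)
      fix x show "k x \<in> extensional T" using eT unfolding k_def extensional_def by auto
    next
      fix t assume t: "t \<in> T"
      show "continuous_map X euclideanreal (\<lambda>x. k x t)"
      proof (cases "t = e")
        case True then show ?thesis unfolding k_def using w(1) by simp
      next
        case False
        have "continuous_map X euclideanreal (\<lambda>x. h x t + v x * (g (h x) t - h x t))"
          using h'(2) gh' v'(1) t by (intro continuous_intros) auto
        then show ?thesis unfolding k_def using False t by simp
      qed
    next
      fix t x assume t: "t \<in> T" and x: "x \<in> topspace X"
      show "k x t \<in> {0..1}"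
      proof (cases "t = e")
        case True then show ?thesis unfolding k_def using w(2) x by simp
      next
        case False
        have r: "0 \<le> h x t" "h x t \<le> 1" "0 \<le> g (h x) t" "g (h x) t \<le> 1" "0 \<le> v x" "v x \<le> 1"
          using h'(2) gh' v'(2) t x by auto
        have "k x t = (1 - v x) * h x t + v x * g (h x) t" unfolding k_def using False t by (simp add: algebra_simps)
        moreover have "0 \<le> (1 - v x) * h x t + v x * g (h x) t" using r by simp
        moreover have "(1 - v x) * h x t + v x * g (h x) t \<le> 1" using r by (intro convex_bound_le) auto
        ultimately show ?thesis by simp
      qed
    qed
    show "\<forall>y\<in>Y. k y = h y"
    proof
      fix y assume y: "y \<in> Y"
      then have "v y = 0" "w y = h y e" "h y \<in> extensional T" using v(2) w(3) h'(1) sub by blast+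
      then show "k y = h y" unfolding k_def extensional_def by auto
    qed
    show "finite F" "F \<subseteq> T" "\<eta> > 0" using F by blast+
    show "\<forall>x\<in>P \<union> Q. \<forall>z\<in>Z. \<exists>t\<in>F. \<eta> < \<bar>z t - k x t\<bar>"
    proof (intro ballI)
      fix x z assume x: "x \<in> P \<union> Q" and z: "z \<in> Z"
      then have "h x \<in> topspace ?I" using h sub unfolding continuous_map_def by blast
      then obtain t where t: "t \<in> F" "\<eta> < \<bar>z t - g (h x) t\<bar>" using F(4) z by blast
      have "v x = 1" using v(3) x by blast
      then have "k x t = g (h x) t" unfolding k_def using t(1) e F(2) by auto
      then have "\<eta> < \<bar>z t - k x t\<bar>" using t(2) by simp
      then show "\<exists>t\<in>F. \<eta> < \<bar>z t - k x t\<bar>" using t(1) by (rule bexI)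
    qed
    show "e \<in> T - (A \<union> F)" using e by blast
    show "\<forall>x\<in>P. k x e = 0" "\<forall>x\<in>Q. k x e = 1" using w(4,5) unfolding k_def by simp_all
    show "\<forall>x\<in>topspace X. \<forall>t\<in>T - {e}. \<bar>k x t - h x t\<bar> \<le> \<bar>g (h x) t - h x t\<bar>"
    proof (intro ballI)
      fix x t assume "x \<in> topspace X" "t \<in> T - {e}"
      then have "\<bar>k x t - h x t\<bar> = v x * \<bar>g (h x) t - h x t\<bar>" "v x \<le> 1"
        using v'(2) unfolding k_def by (auto simp: abs_mult)
      then show "\<bar>k x t - h x t\<bar> \<le> \<bar>g (h x) t - h x t\<bar>" using mult_right_mono[of "v x" 1 "\<bar>g (h x) t - h x t\<bar>"] by simp
    qed
  qed
qed

section \<open>Countably many coordinates\<close>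

text \<open>Halving the step bounds makes the total later movement at most twice the current bound. The steps are
controlled only from the index \<open>m\<close> on, as a coordinate is under control only once it has been put to use.\<close>
lemma continuous_map_limit_of_small_steps:
  fixes H :: "nat \<Rightarrow> 'a \<Rightarrow> real" and \<delta> :: "nat \<Rightarrow> real"
  assumes cont: "\<And>n. continuous_map X euclideanreal (H n)"
    and \<delta>0: "\<And>n. 0 < \<delta> n" and \<delta>: "\<And>n. \<delta> (Suc n) \<le> \<delta> n / 2" "\<delta> \<longlonglongrightarrow> 0"
    and step: "\<And>n x. m \<le> n \<Longrightarrow> x \<in> topspace X \<Longrightarrow> \<bar>H (Suc n) x - H n x\<bar> \<le> \<delta> n"
  shows "continuous_map X euclideanreal (\<lambda>x. lim (\<lambda>n. H n x))"
    and "\<And>n x. m \<le> n \<Longrightarrow> x \<in> topspace X \<Longrightarrow> \<bar>lim (\<lambda>n. H n x) - H n x\<bar> \<le> 2 * \<delta> n"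
    and "\<And>x. x \<in> topspace X \<Longrightarrow> (\<lambda>n. H n x) \<longlonglongrightarrow> lim (\<lambda>n. H n x)"
proof -
  have close: "\<bar>H (n + k) x - H n x\<bar> \<le> 2 * \<delta> n - 2 * \<delta> (n + k)"
    if "m \<le> n" "x \<in> topspace X" for n k x
  proof (induction k)
    case (Suc k)
    have "\<bar>H (Suc (n + k)) x - H (n + k) x\<bar> \<le> \<delta> (n + k)" using step[of "n + k" x] that by simp
    then show ?case using Suc \<delta>(1)[of "n + k"] by (simp add: abs_le_iff)
  qed simp
  have close': "\<bar>H k x - H n x\<bar> \<le> 2 * \<delta> n" if "m \<le> n" "n \<le> k" "x \<in> topspace X" for n k x
    using close[of n x "k - n"] \<delta>0[of k] that by simp
  show lim: "(\<lambda>n. H n x) \<longlonglongrightarrow> lim (\<lambda>n. H n x)" if x: "x \<in> topspace X" for x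
  proof -
    have "Cauchy (\<lambda>n. H n x)"
    proof (rule metric_CauchyI)
      fix e :: real assume "e > 0"
      then obtain N where N: "\<forall>n\<ge>N. \<delta> n < e / 4"
        using order_tendstoD(2)[OF \<delta>(2), of "e/4"] unfolding eventually_sequentially by auto
      let ?N = "max m N"
      show "\<exists>M. \<forall>k\<ge>M. \<forall>l\<ge>M. dist (H k x) (H l x) < e"
      proof (intro exI[of _ ?N] allI impI)
        fix k l assume "?N \<le> k" "?N \<le> l"
        then have "\<bar>H k x - H ?N x\<bar> \<le> 2 * \<delta> ?N" "\<bar>H l x - H ?N x\<bar> \<le> 2 * \<delta> ?N" "\<delta> ?N < e / 4"
          using close'[OF _ _ x, of ?N] N by auto
        then show "dist (H k x) (H l x) < e" unfolding dist_real_def by linarith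
      qed
    qed
    then show ?thesis by (simp add: Cauchy_convergent_iff convergent_LIMSEQ_iff)
  qed
  show lim_close: "\<bar>lim (\<lambda>n. H n x) - H n x\<bar> \<le> 2 * \<delta> n" if "m \<le> n" "x \<in> topspace X" for n x
  proof (rule LIMSEQ_le_const2)
    show "(\<lambda>k. \<bar>H k x - H n x\<bar>) \<longlonglongrightarrow> \<bar>lim (\<lambda>n. H n x) - H n x\<bar>"
      by (intro tendsto_intros lim that)
    show "\<exists>N. \<forall>k\<ge>N. \<bar>H k x - H n x\<bar> \<le> 2 * \<delta> n" using close'[OF that(1) _ that(2)] by blast
  qed
  show "continuous_map X euclideanreal (\<lambda>x. lim (\<lambda>n. H n x))"
    unfolding mtopology_is_euclidean[symmetric]
  proof (rule Met_TC.continuous_map_uniform_limit[where F=sequentially and f=H])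
    show "\<forall>\<^sub>F n in sequentially. continuous_map X Met_TC.mtopology (H n)"
      using cont by (simp add: mtopology_is_euclidean)
    fix e :: real assume "e > 0"
    then have "\<forall>\<^sub>F n in sequentially. \<delta> n < e / 2" using order_tendstoD(2)[OF \<delta>(2), of "e/2"] by simp
    then show "\<forall>\<^sub>F n in sequentially. \<forall>x\<in>topspace X.
        lim (\<lambda>n. H n x) \<in> UNIV \<and> dist (H n x) (lim (\<lambda>n. H n x)) < e"
      using eventually_ge_at_top[of m]
    proof eventually_elim
      case (elim n)
      show ?case
      proof (intro ballI conjI)
        fix x assume "x \<in> topspace X"
        then have "\<bar>lim (\<lambda>n. H n x) - H n x\<bar> \<le> 2 * \<delta> n" using lim_close elim by blast
        then show "dist (H n x) (lim (\<lambda>n. H n x)) < e" using elim unfolding dist_real_def by linarith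
      qed simp
    qed
  qed simp
qed

text \<open>The state of the recursion is \<open>(h, K, \<delta>, e)\<close>: the current map, the finite set of coordinates whose values
matter from now on, the bound on the next movement of these coordinates, and the fresh coordinate of the
last step. A bijection with the natural numbers puts one new coordinate into \<open>K\<close> at every step, so that all
coordinates converge. Each step leaves a margin of more than \<open>2 * \<delta>'\<close>, which bounds all later movements together.\<close>
lemma general_position_countable:
  fixes T :: "'i set" and \<tau> :: "'k rel" and f :: "'a \<Rightarrow> 'i \<Rightarrow> real" and P Q :: "'i \<Rightarrow> 'a set"
  assumes \<tau>: "Card_order \<tau>" "natLeq \<le>o \<tau>" and Z: "Z_set_in \<tau> (tychonov_cube T) Z"
    and T: "countable T" "infinite T"
    and X: "normal_space X" and Y: "closedin X Y" and f: "continuous_map X (tychonov_cube T) f"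
    and cl: "\<And>k. k \<in> T \<Longrightarrow> closedin X (P k)" "\<And>k. k \<in> T \<Longrightarrow> closedin X (Q k)"
    and disj: "\<And>k. k \<in> T \<Longrightarrow> P k \<inter> Q k = {}" "\<And>k. k \<in> T \<Longrightarrow> (P k \<union> Q k) \<inter> Y = {}"
  shows "\<exists>h e. continuous_map X (tychonov_cube T) h \<and> (\<forall>y\<in>Y. h y = f y) \<and> inj_on e T \<and> e ` T \<subseteq> T \<and>
    (\<forall>k\<in>T. h ` (P k \<union> Q k) \<inter> Z = {} \<and> (\<forall>x\<in>P k. h x (e k) \<le> 1/4) \<and> (\<forall>x\<in>Q k. h x (e k) \<ge> 3/4))"
proof -
  let ?I = "tychonov_cube T"
  let ?b = "from_nat_into T"
  have b: "bij_betw ?b UNIV T" by (rule bij_betw_from_nat_into[OF T])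
  have bT: "?b n \<in> T" for n using b unfolding bij_betw_def by blast
  have Zcl: "closedin ?I Z" using Z unfolding Z_set_in_def by blast
  define good where "good s \<longleftrightarrow> (case s of (h, K, \<delta>, e) \<Rightarrow> continuous_map X ?I h \<and> (\<forall>y\<in>Y. h y = f y) \<and>
      finite K \<and> K \<subseteq> T \<and> 0 < \<delta>)" for s :: "('a \<Rightarrow> 'i \<Rightarrow> real) \<times> 'i set \<times> real \<times> 'i"
  define next_ok where "next_ok n s s' \<longleftrightarrow> (case s of (h, K, \<delta>, _) \<Rightarrow> case s' of (h', K', \<delta>', e) \<Rightarrow>
      K \<subseteq> K' \<and> ?b n \<in> K' \<and> \<delta>' \<le> \<delta> / 2 \<and> \<delta>' \<le> 1 / 8 \<and> e \<in> K' - K \<and>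
      (\<forall>x\<in>topspace X. \<forall>t\<in>K. \<bar>h' x t - h x t\<bar> \<le> \<delta>) \<and>
      (\<forall>x\<in>P (?b n) \<union> Q (?b n). \<forall>z\<in>Z. \<exists>t\<in>K'. 2 * \<delta>' < \<bar>z t - h' x t\<bar>) \<and>
      (\<forall>x\<in>P (?b n). h' x e = 0) \<and> (\<forall>x\<in>Q (?b n). h' x e = 1))"
    for n and s s' :: "('a \<Rightarrow> 'i \<Rightarrow> real) \<times> 'i set \<times> real \<times> 'i"
  have start: "good (f, {}, 1, undefined)" unfolding good_def using f by simp
  have "\<exists>s'. good s' \<and> next_ok n s s'" if good: "good s" for n s
  proof -
    obtain h K \<delta> e0 where s: "s = (h, K, \<delta>, e0)" by (cases s)
    have h: "continuous_map X ?I h" "\<forall>y\<in>Y. h y = f y" and K: "finite K" "K \<subseteq> T" and \<delta>: "0 < \<delta>"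
      using good unfolding good_def s by simp_all
    obtain g where g: "continuous_map ?I ?I g" "\<forall>z\<in>topspace ?I. \<forall>a\<in>K. \<bar>g z a - z a\<bar> < \<delta>"
      "g ` topspace ?I \<inter> Z = {}"
      by (rule Z_set_approx_move[OF \<tau> Z K \<delta>])
    have TK: "infinite (T - K)" using T(2) K(1) by simp
    obtain h' F \<eta> e where h': "continuous_map X ?I h'" "\<forall>y\<in>Y. h' y = h y"
      "finite F" "F \<subseteq> T" "\<eta> > 0" "\<forall>x\<in>P (?b n) \<union> Q (?b n). \<forall>z\<in>Z. \<exists>t\<in>F. \<eta> < \<bar>z t - h' x t\<bar>"
      "e \<in> T - (K \<union> F)" "\<forall>x\<in>P (?b n). h' x e = 0" "\<forall>x\<in>Q (?b n). h' x e = 1"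
      "\<forall>x\<in>topspace X. \<forall>t\<in>T - {e}. \<bar>h' x t - h x t\<bar> \<le> \<bar>g (h x) t - h x t\<bar>"
      by (rule push_off_step[OF X Y cl(1)[OF bT] cl(2)[OF bT] disj(1)[OF bT] disj(2)[OF bT] h(1) g(1,3) Zcl TK])
    \<comment> \<open>The bound \<open>1 / 8\<close> keeps the values \<open>0\<close> and \<open>1\<close> in the fresh coordinate correct up to \<open>1 / 4\<close> in the limit.\<close>
    define \<delta>' where "\<delta>' = min (min (\<delta> / 2) (1 / 8)) (\<eta> / 2)"
    define K' where "K' = insert e (insert (?b n) (K \<union> F))"
    have \<delta>': "0 < \<delta>'" "\<delta>' \<le> \<delta> / 2" "\<delta>' \<le> 1 / 8" "2 * \<delta>' \<le> \<eta>"
      using \<delta> h'(5) unfolding \<delta>'_def by auto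
    have K': "K \<subseteq> K'" "?b n \<in> K'" "e \<in> K' - K" using h'(7) unfolding K'_def by blast+
    have "good (h', K', \<delta>', e)"
      unfolding good_def using h' h(2) K \<delta>'(1) bT[of n] unfolding K'_def by simp
    moreover have "\<bar>h' x t - h x t\<bar> \<le> \<delta>" if x: "x \<in> topspace X" and t: "t \<in> K" for x t
    proof -
      have "t \<in> T - {e}" using t K(2) h'(7) by blast
      then have "\<bar>h' x t - h x t\<bar> \<le> \<bar>g (h x) t - h x t\<bar>" using h'(10) x by blast
      moreover have "h x \<in> topspace ?I" using h(1) x unfolding continuous_map_def by blast
      then have "\<bar>g (h x) t - h x t\<bar> < \<delta>" using g(2) t by blast
      ultimately show ?thesis by linarith
    qed
    moreover have "\<exists>t\<in>K'. 2 * \<delta>' < \<bar>z t - h' x t\<bar>"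
      if x: "x \<in> P (?b n) \<union> Q (?b n)" and z: "z \<in> Z" for x z
    proof -
      obtain t where t: "t \<in> F" "\<eta> < \<bar>z t - h' x t\<bar>" using h'(6) x z by blast
      then have "2 * \<delta>' < \<bar>z t - h' x t\<bar>" using \<delta>'(4) by linarith
      moreover have "t \<in> K'" using t(1) unfolding K'_def by blast
      ultimately show ?thesis by blast
    qed
    ultimately have "good (h', K', \<delta>', e) \<and> next_ok n s (h', K', \<delta>', e)"
      unfolding next_ok_def s using \<delta>'(2,3) h'(8,9) K' by simp
    then show ?thesis by blast
  qed
  note step_exists = this
  have "\<exists>s. \<forall>n. good (s n) \<and> next_ok n (s n) (s (Suc n))"
    by (rule dependent_nat_choice[of "\<lambda>_. good" next_ok]) (rule exI, rule start, rule step_exists)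
  then obtain s where s: "\<forall>n. good (s n)" "\<forall>n. next_ok n (s n) (s (Suc n))" by blast
  define H K \<delta> E where HK: "H n = fst (s n)" "K n = fst (snd (s n))" "\<delta> n = fst (snd (snd (s n)))"
    "E n = snd (snd (snd (s (Suc n))))" for n
  have g: "continuous_map X ?I (H n)" "\<forall>y\<in>Y. H n y = f y" "K n \<subseteq> T" "0 < \<delta> n" for n
    using spec[OF s(1), of n] unfolding good_def HK by (simp_all add: case_prod_beta)
  have "K n \<subseteq> K (Suc n) \<and> ?b n \<in> K (Suc n) \<and> \<delta> (Suc n) \<le> \<delta> n / 2 \<and> \<delta> (Suc n) \<le> 1 / 8 \<and> E n \<in> K (Suc n) - K n \<and>
      (\<forall>x\<in>topspace X. \<forall>t\<in>K n. \<bar>H (Suc n) x t - H n x t\<bar> \<le> \<delta> n) \<and>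
      (\<forall>x\<in>P (?b n) \<union> Q (?b n). \<forall>z\<in>Z. \<exists>t\<in>K (Suc n). 2 * \<delta> (Suc n) < \<bar>z t - H (Suc n) x t\<bar>) \<and>
      (\<forall>x\<in>P (?b n). H (Suc n) x (E n) = 0) \<and> (\<forall>x\<in>Q (?b n). H (Suc n) x (E n) = 1)" for n
    using spec[OF s(2), of n] unfolding next_ok_def HK by (simp add: case_prod_beta)
  then have K: "K n \<subseteq> K (Suc n)" "?b n \<in> K (Suc n)" and \<delta>: "\<delta> (Suc n) \<le> \<delta> n / 2" "\<delta> (Suc n) \<le> 1 / 8"
    and E: "E n \<in> K (Suc n) - K n"
    and step: "\<forall>x\<in>topspace X. \<forall>t\<in>K n. \<bar>H (Suc n) x t - H n x t\<bar> \<le> \<delta> n"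
    and off: "\<forall>x\<in>P (?b n) \<union> Q (?b n). \<forall>z\<in>Z. \<exists>t\<in>K (Suc n). 2 * \<delta> (Suc n) < \<bar>z t - H (Suc n) x t\<bar>"
    and val: "\<forall>x\<in>P (?b n). H (Suc n) x (E n) = 0" "\<forall>x\<in>Q (?b n). H (Suc n) x (E n) = 1" for n
    by simp_all
  have Kmono: "K m \<subseteq> K n" if "m \<le> n" for m n
    using K(1) that by (rule lift_Suc_mono_le)
  have \<delta>_bound: "\<delta> n \<le> \<delta> 0 * (1 / 2) ^ n" for n
  proof (induction n)
    case (Suc n)
    then show ?case using \<delta>(1)[of n] by simp
  qed simp
  have \<delta>lim: "\<delta> \<longlonglongrightarrow> 0"
  proof (rule tendsto_sandwich)
    show "(\<lambda>n. 0 :: real) \<longlonglongrightarrow> 0" by (rule tendsto_const)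
    show "(\<lambda>n. \<delta> 0 * (1 / 2) ^ n) \<longlonglongrightarrow> 0"
      by (rule tendsto_mult_right_zero) (rule LIMSEQ_realpow_zero, simp_all)
    show "\<forall>\<^sub>F n in sequentially. 0 \<le> \<delta> n"
      by (rule always_eventually) (intro allI less_imp_le g(4))
    show "\<forall>\<^sub>F n in sequentially. \<delta> n \<le> \<delta> 0 * (1 / 2) ^ n"
      by (rule always_eventually) (intro allI \<delta>_bound)
  qed
  have Hc: "continuous_map X euclideanreal (\<lambda>x. H n x t)" "\<forall>x\<in>topspace X. H n x t \<in> {0..1}" if "t \<in> T" for n t
    using g(1)[of n] that unfolding continuous_map_tychonov_cube by blast+
  have KT: "t \<in> (\<Union>n. K n)" if "t \<in> T" for t
  proof -
    obtain n where "t = ?b n" using b \<open>t \<in> T\<close> unfolding bij_betw_def by blast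
    then show ?thesis using K(2) by blast
  qed
  define h where "h x = restrict (\<lambda>t. lim (\<lambda>n. H n x t)) T" for x
  have limits: "continuous_map X euclideanreal (\<lambda>x. h x t)"
      "\<forall>n x. m \<le> n \<longrightarrow> x \<in> topspace X \<longrightarrow> \<bar>h x t - H n x t\<bar> \<le> 2 * \<delta> n"
      "\<forall>x\<in>topspace X. (\<lambda>n. H n x t) \<longlonglongrightarrow> h x t"
    if t: "t \<in> K m" for t m
  proof -
    have tT: "t \<in> T" using g(3) t by blast
    have st: "\<bar>H (Suc n) x t - H n x t\<bar> \<le> \<delta> n" if "m \<le> n" "x \<in> topspace X" for n x
      using step[of n] that Kmono[OF that(1)] t by blast
    have h_eq: "h x t = lim (\<lambda>n. H n x t)" for x using tT unfolding h_def by simp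
    note lims = continuous_map_limit_of_small_steps[where H="\<lambda>n x. H n x t",
        OF Hc(1)[OF tT] g(4) \<delta>(1) \<delta>lim st]
    show "continuous_map X euclideanreal (\<lambda>x. h x t)" unfolding h_eq by (rule lims(1))
    show "\<forall>n x. m \<le> n \<longrightarrow> x \<in> topspace X \<longrightarrow> \<bar>h x t - H n x t\<bar> \<le> 2 * \<delta> n"
      unfolding h_eq by (intro allI impI lims(2))
    show "\<forall>x\<in>topspace X. (\<lambda>n. H n x t) \<longlonglongrightarrow> h x t" unfolding h_eq by (intro ballI lims(3))
  qed
  have hc: "continuous_map X ?I h"
    unfolding continuous_map_tychonov_cube
  proof (intro conjI ballI)
    fix x show "h x \<in> extensional T" unfolding h_def by simp
  next
    fix t assume "t \<in> T"
    then obtain m where m: "t \<in> K m" using KT by blast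
    then show "continuous_map X euclideanreal (\<lambda>x. h x t)" by (rule limits(1))
  next
    fix t x assume tx: "t \<in> T" "x \<in> topspace X"
    then obtain m where m: "t \<in> K m" using KT by blast
    have "(\<lambda>n. H n x t) \<longlonglongrightarrow> h x t" using limits(3)[OF m] tx by blast
    then show "h x t \<in> {0..1}"
      by (rule closed_sequentially[OF closed_atLeastAtMost, rotated]) (use Hc(2) tx in blast)
  qed
  have close: "\<bar>h x t - H (Suc n) x t\<bar> \<le> 2 * \<delta> (Suc n)" if "t \<in> K (Suc n)" "x \<in> topspace X" for t n x
    using limits(2)[OF that(1)] that(2) by blast
  have YX: "Y \<subseteq> topspace X" using Y by (rule closedin_subset)
  have hY: "h y = f y" if y: "y \<in> Y" for y
  proof
    fix t
    show "h y t = f y t"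
    proof (cases "t \<in> T")
      case True
      have "H n y t = f y t" for n using g(2)[of n] y by simp
      then show ?thesis using True unfolding h_def by simp
    next
      case False
      have "f y \<in> extensional T" using f y YX unfolding continuous_map_tychonov_cube by blast
      then show ?thesis using False unfolding h_def extensional_def by simp
    qed
  qed
  define e where "e k = E (the_inv_into UNIV ?b k)" for k
  have inv: "the_inv_into UNIV ?b (?b n) = n" for n
    by (rule the_inv_into_f_f) (use b in \<open>simp_all add: bij_betw_def\<close>)
  have Einj: "E m \<noteq> E n" if "m < n" for m n
    using E[of m] E[of n] Kmono[of "Suc m" n] that by auto
  have eb: "e (?b n) = E n" for n unfolding e_def inv ..
  have enum: "\<exists>n. ?b n = k" if "k \<in> T" for k by (rule from_nat_into_surj[OF T(1) that])
  have "inj_on e T"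
  proof (rule inj_onI)
    fix k l assume kl: "k \<in> T" "l \<in> T" "e k = e l"
    obtain m n where mn: "?b m = k" "?b n = l" using enum kl(1,2) by blast
    have "E m = E n" using eb[of m] eb[of n] kl(3) unfolding mn by simp
    then have "m = n" using Einj[of m n] Einj[of n m] by (cases m n rule: linorder_cases) simp_all
    then show "k = l" using mn by simp
  qed
  moreover have "e ` T \<subseteq> T"
  proof clarify
    fix k assume "k \<in> T"
    then obtain n where n: "?b n = k" using enum by blast
    have "e k = E n" using eb[of n] unfolding n .
    then show "e k \<in> T" using E[of n] g(3)[of "Suc n"] by auto
  qed
  moreover have "h ` (P k \<union> Q k) \<inter> Z = {} \<and> (\<forall>x\<in>P k. h x (e k) \<le> 1/4) \<and> (\<forall>x\<in>Q k. h x (e k) \<ge> 3/4)"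
    if k: "k \<in> T" for k
  proof -
    obtain n where n: "?b n = k" using enum[OF k] by blast
    have ek: "e k = E n" using eb[of n] unfolding n .
    have PX: "P k \<subseteq> topspace X" "Q k \<subseteq> topspace X" using cl[OF k] closedin_subset by blast+
    have off_Z: "h x \<notin> Z" if x: "x \<in> P k \<union> Q k" for x
    proof
      assume "h x \<in> Z"
      then obtain t where "t \<in> K (Suc n)" "2 * \<delta> (Suc n) < \<bar>h x t - H (Suc n) x t\<bar>"
        using off[of n] x unfolding n by blast
      moreover have "x \<in> topspace X" using x PX by blast
      ultimately show False using close[of t n x] by linarith
    qed
    have near: "\<bar>h x (E n) - H (Suc n) x (E n)\<bar> \<le> 1 / 4" if x: "x \<in> P k \<union> Q k" for x
    proof -
      have "x \<in> topspace X" using x PX by blast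
      then have "\<bar>h x (E n) - H (Suc n) x (E n)\<bar> \<le> 2 * \<delta> (Suc n)" using close[of "E n" n x] E[of n] by blast
      then show ?thesis using \<delta>(2)[of n] by linarith
    qed
    have "h x (e k) \<le> 1 / 4" if x: "x \<in> P k" for x
    proof -
      have "H (Suc n) x (E n) = 0" using val(1)[of n] x unfolding n by blast
      moreover have "\<bar>h x (E n) - H (Suc n) x (E n)\<bar> \<le> 1 / 4" using near x by blast
      ultimately show ?thesis unfolding ek by linarith
    qed
    moreover have "3 / 4 \<le> h x (e k)" if x: "x \<in> Q k" for x
    proof -
      have "H (Suc n) x (E n) = 1" using val(2)[of n] x unfolding n by blast
      moreover have "\<bar>h x (E n) - H (Suc n) x (E n)\<bar> \<le> 1 / 4" using near x by blast
      ultimately show ?thesis unfolding ek by linarith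
    qed
    moreover have "h ` (P k \<union> Q k) \<inter> Z = {}" using off_Z by blast
    ultimately show ?thesis by simp
  qed
  ultimately show ?thesis using hc hY by (intro exI[of _ h] exI[of _ e]) simp
qed

section \<open>Uncountably many coordinates\<close>

text \<open>A map into the cube can be prescribed on disjoint blocks of coordinates independently. This is what makes
limit stages of the transfinite construction harmless.\<close>
lemma glue_coordinate_blocks:
  fixes T :: "'i set" and f :: "'a \<Rightarrow> 'i \<Rightarrow> real"
  assumes f: "continuous_map X (tychonov_cube T) f" and YX: "Y \<subseteq> topspace X"
    and w: "\<And>j. j \<in> S \<Longrightarrow> continuous_map X (tychonov_cube T) (w j)" "\<And>j. j \<in> S \<Longrightarrow> \<forall>y\<in>Y. w j y = f y"
    and B: "\<And>j. j \<in> S \<Longrightarrow> B j \<subseteq> T" "\<And>i j. i \<in> S \<Longrightarrow> j \<in> S \<Longrightarrow> i \<noteq> j \<Longrightarrow> B i \<inter> B j = {}"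
  obtains \<psi> where "continuous_map X (tychonov_cube T) \<psi>" "\<forall>y\<in>Y. \<psi> y = f y"
    "\<forall>j\<in>S. \<forall>t\<in>B j. \<forall>x. \<psi> x t = w j x t"
proof -
  let ?I = "tychonov_cube T"
  define src where "src t = (if \<exists>j\<in>S. t \<in> B j then w (THE j. j \<in> S \<and> t \<in> B j) else f)" for t
  have src_block: "src t = w j" if "j \<in> S" "t \<in> B j" for j t
  proof -
    have "(THE j. j \<in> S \<and> t \<in> B j) = j" by (rule the_equality) (use that B(2) in blast)+
    then show ?thesis using that unfolding src_def by auto
  qed
  have src_cases: "src t = f \<or> (\<exists>j\<in>S. src t = w j)" for t
  proof (cases "\<exists>j\<in>S. t \<in> B j")
    case True
    then show ?thesis using src_block by blast
  next
    case False
    then show ?thesis unfolding src_def by simp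
  qed
  have src: "continuous_map X ?I (src t)" "\<forall>y\<in>Y. src t y = f y" for t
    using src_cases[of t] f w by auto
  have comp: "continuous_map X euclideanreal (\<lambda>x. src t x t)" "\<forall>x\<in>topspace X. src t x t \<in> {0..1}"
    if "t \<in> T" for t
    using src(1)[of t] that unfolding continuous_map_tychonov_cube by blast+
  define \<psi> where "\<psi> x = restrict (\<lambda>t. src t x t) T" for x
  show thesis
  proof
    show "continuous_map X ?I \<psi>"
      unfolding continuous_map_tychonov_cube \<psi>_def using comp by simp
    show "\<forall>y\<in>Y. \<psi> y = f y"
    proof
      fix y assume y: "y \<in> Y"
      then have "f y \<in> extensional T" using f YX unfolding continuous_map_tychonov_cube by blast
      moreover have "\<psi> y = restrict (f y) T" unfolding \<psi>_def using src(2) y by (auto intro!: restrict_ext)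
      ultimately show "\<psi> y = f y" by (simp add: extensional_restrict)
    qed
    show "\<forall>j\<in>S. \<forall>t\<in>B j. \<forall>x. \<psi> x t = w j x t"
    proof (intro ballI allI)
      fix j t x assume jt: "j \<in> S" "t \<in> B j"
      then have "t \<in> T" using B(1) by blast
      then show "\<psi> x t = w j x t" unfolding \<psi>_def using src_block[OF jt] by simp
    qed
  qed
qed

lemma infinite_Diff_of_smaller_card:
  assumes "infinite T" "|A| <o |T|"
  shows "infinite (T - A)"
proof
  assume "finite (T - A)"
  then have "|T - A| <o |T|" using assms(1)
    by (intro finite_ordLess_infinite card_of_Well_order) (simp_all add: Field_card_of)
  then have "|A \<union> (T - A)| <o |T|"
    using card_of_Un_ordLess_infinite[OF assms(1) assms(2)] by blast
  moreover have "|T| \<le>o |A \<union> (T - A)|" by (intro card_of_mono1) blast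
  ultimately show False using not_ordLess_ordLeq by blast
qed

text \<open>The recursion runs along the well-order \<open>|T|\<close>, all of whose proper initial segments have fewer than \<open>\<tau>\<close>
elements. Stage \<open>k\<close> produces a triple: a finite block of coordinates disjoint from all earlier blocks, a map into
the cube of which only the coordinates in the block are used later, and the fresh coordinate. Points of
\<open>P k \<union> Q k\<close> leave \<open>Z\<close> in a coordinate of the new block or of an earlier one, and no later stage touches these.\<close>
lemma general_position_uncountable:
  fixes T :: "'i set" and \<tau> :: "'k rel" and f :: "'a \<Rightarrow> 'i \<Rightarrow> real" and P Q :: "'i \<Rightarrow> 'a set"
  assumes \<tau>: "Card_order \<tau>" "natLeq <o \<tau>" "|T| =o \<tau>" and Z: "Z_set_in \<tau> (tychonov_cube T) Z"
    and T: "infinite T"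
    and X: "normal_space X" and Y: "closedin X Y" and f: "continuous_map X (tychonov_cube T) f"
    and cl: "\<And>k. k \<in> T \<Longrightarrow> closedin X (P k)" "\<And>k. k \<in> T \<Longrightarrow> closedin X (Q k)"
    and disj: "\<And>k. k \<in> T \<Longrightarrow> P k \<inter> Q k = {}" "\<And>k. k \<in> T \<Longrightarrow> (P k \<union> Q k) \<inter> Y = {}"
  shows "\<exists>h e. continuous_map X (tychonov_cube T) h \<and> (\<forall>y\<in>Y. h y = f y) \<and> inj_on e T \<and> e ` T \<subseteq> T \<and>
    (\<forall>k\<in>T. h ` (P k \<union> Q k) \<inter> Z = {} \<and> (\<forall>x\<in>P k. h x (e k) \<le> 1/4) \<and> (\<forall>x\<in>Q k. h x (e k) \<ge> 3/4))"
proof -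
  let ?I = "tychonov_cube T"
  have \<tau>': "natLeq \<le>o \<tau>" by (rule ordLess_imp_ordLeq[OF \<tau>(2)])
  have YX: "Y \<subseteq> topspace X" using Y by (rule closedin_subset)
  have Zcl: "closedin ?I Z" using Z unfolding Z_set_in_def by blast
  have Field: "Field |T| = T" by (rule Field_card_of)
  define pre where "pre k = underS |T| k" for k
  have pre_T: "pre k \<subseteq> T" for k
  proof
    fix j assume "j \<in> pre k"
    then have "(j, k) \<in> |T|" unfolding pre_def underS_def by simp
    then have "j \<in> Field |T|" by (rule FieldI1)
    then show "j \<in> T" unfolding Field .
  qed
  have wo: "wo_rel |T|" unfolding wo_rel_def by (rule card_of_Well_order)
  have pre_total: "j \<in> pre k \<or> k \<in> pre j" if "j \<in> T" "k \<in> T" "j \<noteq> k" for j k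
    using wo_rel.TOTALS[OF wo] that unfolding pre_def underS_def Field by blast
  define R where "R = {(j, k). j \<in> pre k}"
  have "R = |T| - Id" unfolding R_def pre_def underS_def by auto
  then have wfR: "wf R" using wo_rel.WF[OF wo] by simp
  have card_pre: "|pre k| <o \<tau>" if "k \<in> T" for k
  proof -
    have "|pre k| <o |T|" unfolding pre_def by (rule card_of_underS[OF card_of_Card_order]) (simp add: Field that)
    then show ?thesis using \<tau>(3) by (rule ordLess_ordIso_trans)
  qed
  define block where "block r = fst r" for r :: "'i set \<times> ('a \<Rightarrow> 'i \<Rightarrow> real) \<times> 'i"
  define wit where "wit r = fst (snd r)" for r :: "'i set \<times> ('a \<Rightarrow> 'i \<Rightarrow> real) \<times> 'i"
  define spare where "spare r = snd (snd r)" for r :: "'i set \<times> ('a \<Rightarrow> 'i \<Rightarrow> real) \<times> 'i"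
  define ok where "ok s k r \<longleftrightarrow> (k \<in> T \<longrightarrow> finite (block r) \<and> block r \<subseteq> T \<and>
      (\<forall>j\<in>pre k. block (s j) \<inter> block r = {}) \<and>
      continuous_map X ?I (wit r) \<and> (\<forall>y\<in>Y. wit r y = f y) \<and> spare r \<in> block r \<and>
      (\<forall>x\<in>P k. wit r x (spare r) = 0) \<and> (\<forall>x\<in>Q k. wit r x (spare r) = 1) \<and>
      (\<forall>x\<in>P k \<union> Q k. \<forall>z\<in>Z. (\<exists>t\<in>block r. z t \<noteq> wit r x t) \<or>
         (\<exists>j\<in>pre k. \<exists>t\<in>block (s j). z t \<noteq> wit (s j) x t)))" for s k r
  have "\<exists>s. \<forall>k. ok s k (s k)"
  proof (rule dependent_wf_choice[OF wfR, of ok])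
    fix s s' :: "'i \<Rightarrow> 'i set \<times> ('a \<Rightarrow> 'i \<Rightarrow> real) \<times> 'i" and k r
    assume "\<And>j. (j, k) \<in> R \<Longrightarrow> s j = s' j"
    then have eq: "s j = s' j" if "j \<in> pre k" for j using that unfolding R_def by simp
    show "ok s k r = ok s' k r" unfolding ok_def by (simp add: eq cong: ball_cong bex_cong)
  next
    fix k and s :: "'i \<Rightarrow> 'i set \<times> ('a \<Rightarrow> 'i \<Rightarrow> real) \<times> 'i"
    assume "\<And>j. (j, k) \<in> R \<Longrightarrow> ok s j (s j)"
    then have IH: "ok s j (s j)" if "j \<in> pre k" for j using that unfolding R_def by simp
    show "\<exists>r. ok s k r"
    proof (cases "k \<in> T")
      case False
      then show ?thesis unfolding ok_def by simp
    next
      case True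
      have IH': "finite (block (s j))" "block (s j) \<subseteq> T" "\<forall>i\<in>pre j. block (s i) \<inter> block (s j) = {}"
          "continuous_map X ?I (wit (s j))" "\<forall>y\<in>Y. wit (s j) y = f y" if "j \<in> pre k" for j
        using IH[OF that] subsetD[OF pre_T that] unfolding ok_def by simp_all
      have disj_blocks: "block (s i) \<inter> block (s j) = {}" if "i \<in> pre k" "j \<in> pre k" "i \<noteq> j" for i j
        using pre_total[OF subsetD[OF pre_T that(1)] subsetD[OF pre_T that(2)] that(3)] IH'(3)[OF that(1)] IH'(3)[OF that(2)]
        by blast
      obtain \<psi> where \<psi>: "continuous_map X ?I \<psi>" "\<forall>y\<in>Y. \<psi> y = f y"
        "\<forall>j\<in>pre k. \<forall>t\<in>block (s j). \<forall>x. \<psi> x t = wit (s j) x t"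
        by (rule glue_coordinate_blocks[OF f YX, of "pre k" "\<lambda>j. wit (s j)" "\<lambda>j. block (s j)"])
          (use IH' disj_blocks in simp_all)
      define A where "A = (\<Union>j\<in>pre k. block (s j))"
      have AT: "A \<subseteq> T" unfolding A_def using IH'(2) by blast
      have Acard: "|A| <o \<tau>" unfolding A_def
        by (rule card_of_UN_finite_ordLess[OF \<tau>(1) \<tau>' card_pre[OF True] IH'(1)])
      then have TA: "infinite (T - A)"
        using infinite_Diff_of_smaller_card[OF T] ordLess_ordIso_trans ordIso_symmetric[OF \<tau>(3)] by blast
      obtain g where g: "continuous_map ?I ?I g" "\<forall>z\<in>topspace ?I. \<forall>a\<in>A. g z a = z a"
        "g ` topspace ?I \<inter> Z = {}"
        by (rule Z_set_exact_move[OF \<tau>(1,2) Z Acard AT])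
      obtain h F \<eta> e where h: "continuous_map X ?I h" "\<forall>y\<in>Y. h y = \<psi> y"
        "finite F" "F \<subseteq> T" "\<eta> > 0" "\<forall>x\<in>P k \<union> Q k. \<forall>z\<in>Z. \<exists>t\<in>F. \<eta> < \<bar>z t - h x t\<bar>"
        "e \<in> T - (A \<union> F)" "\<forall>x\<in>P k. h x e = 0" "\<forall>x\<in>Q k. h x e = 1"
        "\<forall>x\<in>topspace X. \<forall>t\<in>T - {e}. \<bar>h x t - \<psi> x t\<bar> \<le> \<bar>g (\<psi> x) t - \<psi> x t\<bar>"
        by (rule push_off_step[OF X Y cl(1)[OF True] cl(2)[OF True] disj(1)[OF True] disj(2)[OF True] \<psi>(1) g(1,3) Zcl TA])
      let ?B = "insert e (F - A)"
      have same: "h x t = \<psi> x t" if "x \<in> topspace X" "t \<in> A" for x t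
      proof -
        have "\<psi> x \<in> topspace ?I" using \<psi>(1) that(1) unfolding continuous_map_def by blast
        then have "g (\<psi> x) t = \<psi> x t" using g(2) that(2) by blast
        moreover have "t \<in> T - {e}" using that(2) AT h(7) by blast
        then have "\<bar>h x t - \<psi> x t\<bar> \<le> \<bar>g (\<psi> x) t - \<psi> x t\<bar>" using h(10) that(1) by blast
        ultimately show ?thesis by simp
      qed
      have PX: "P k \<union> Q k \<subseteq> topspace X" using cl[OF True] closedin_subset by blast
      have off: "(\<exists>t\<in>?B. z t \<noteq> h x t) \<or> (\<exists>j\<in>pre k. \<exists>t\<in>block (s j). z t \<noteq> wit (s j) x t)"
        if x: "x \<in> P k \<union> Q k" and z: "z \<in> Z" for x z
      proof -
        obtain t where t: "t \<in> F" "\<eta> < \<bar>z t - h x t\<bar>" using h(6) x z by blast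
        then have ne: "z t \<noteq> h x t" using h(5) by auto
        show ?thesis
        proof (cases "t \<in> A")
          case True
          then obtain j where j: "j \<in> pre k" "t \<in> block (s j)" unfolding A_def by blast
          have "h x t = wit (s j) x t" using same[OF subsetD[OF PX x] True] \<psi>(3) j by simp
          then show ?thesis using ne j by metis
        next
          case False
          then have "t \<in> ?B" using t(1) by blast
          then show ?thesis using ne by blast
        qed
      qed
      have "finite ?B" "?B \<subseteq> T" using h(3,4,7) by auto
      moreover have "\<forall>j\<in>pre k. block (s j) \<inter> ?B = {}" using h(7) unfolding A_def by blast
      moreover have "\<forall>y\<in>Y. h y = f y" using h(2) \<psi>(2) by simp
      ultimately have "ok s k (?B, h, e)"
        unfolding ok_def block_def[of "(?B, h, e)"] wit_def[of "(?B, h, e)"] spare_def[of "(?B, h, e)"]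
        using h(1,8,9) off unfolding fst_conv snd_conv by (intro impI conjI ballI) simp_all
      then show ?thesis by (rule exI)
    qed
  qed
  then obtain s where s: "\<forall>k. ok s k (s k)" by blast
  have S: "finite (block (s k))" "block (s k) \<subseteq> T" "\<forall>j\<in>pre k. block (s j) \<inter> block (s k) = {}"
      "continuous_map X ?I (wit (s k))" "\<forall>y\<in>Y. wit (s k) y = f y" "spare (s k) \<in> block (s k)"
      "\<forall>x\<in>P k. wit (s k) x (spare (s k)) = 0" "\<forall>x\<in>Q k. wit (s k) x (spare (s k)) = 1"
      "\<forall>x\<in>P k \<union> Q k. \<forall>z\<in>Z. (\<exists>t\<in>block (s k). z t \<noteq> wit (s k) x t) \<or>
         (\<exists>j\<in>pre k. \<exists>t\<in>block (s j). z t \<noteq> wit (s j) x t)" if "k \<in> T" for k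
    using spec[OF s, of k] that unfolding ok_def by simp_all
  have disj_blocks: "block (s i) \<inter> block (s j) = {}" if "i \<in> T" "j \<in> T" "i \<noteq> j" for i j
    using pre_total[OF that] S(3)[OF that(1)] S(3)[OF that(2)] by blast
  obtain h where h: "continuous_map X ?I h" "\<forall>y\<in>Y. h y = f y"
    "\<forall>j\<in>T. \<forall>t\<in>block (s j). \<forall>x. h x t = wit (s j) x t"
    by (rule glue_coordinate_blocks[OF f YX, of T "\<lambda>j. wit (s j)" "\<lambda>j. block (s j)"])
      (use S(2,4,5) disj_blocks in simp_all)
  define e where "e k = spare (s k)" for k
  have "inj_on e T"
  proof (rule inj_onI, rule ccontr)
    fix i j assume ij: "i \<in> T" "j \<in> T" "e i = e j" "i \<noteq> j"
    then show False using S(6)[OF ij(1)] S(6)[OF ij(2)] disj_blocks[OF ij(1,2,4)] unfolding e_def by auto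
  qed
  moreover have "e ` T \<subseteq> T" unfolding e_def using S(2,6) by blast
  moreover have "h ` (P k \<union> Q k) \<inter> Z = {} \<and> (\<forall>x\<in>P k. h x (e k) \<le> 1/4) \<and> (\<forall>x\<in>Q k. h x (e k) \<ge> 3/4)"
    if k: "k \<in> T" for k
  proof (intro conjI ballI)
    have "h x \<notin> Z" if x: "x \<in> P k \<union> Q k" for x
    proof
      assume "h x \<in> Z"
      then have "(\<exists>t\<in>block (s k). h x t \<noteq> wit (s k) x t) \<or>
         (\<exists>j\<in>pre k. \<exists>t\<in>block (s j). h x t \<noteq> wit (s j) x t)" using S(9)[OF k] x by blast
      then show False using h(3) k subsetD[OF pre_T] by blast
    qed
    then show "h ` (P k \<union> Q k) \<inter> Z = {}" by blast
    have eq: "h x (e k) = wit (s k) x (spare (s k))" for x using h(3) S(6)[OF k] k unfolding e_def by blast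
    show "h x (e k) \<le> 1/4" if "x \<in> P k" for x unfolding eq using S(7)[OF k] that by simp
    show "h x (e k) \<ge> 3/4" if "x \<in> Q k" for x unfolding eq using S(8)[OF k] that by simp
  qed
  ultimately show ?thesis using h(1,2) by (intro exI[of _ h] exI[of _ e]) simp
qed

section \<open>The embedding\<close>

lemma general_position:
  fixes T :: "'i set" and \<tau> :: "'k rel" and f :: "'a \<Rightarrow> 'i \<Rightarrow> real" and P Q :: "'i \<Rightarrow> 'a set"
  assumes \<tau>: "Card_order \<tau>" "natLeq \<le>o \<tau>" "|T| =o \<tau>" and Z: "Z_set_in \<tau> (tychonov_cube T) Z"
    and T: "infinite T"
    and X: "normal_space X" and Y: "closedin X Y" and f: "continuous_map X (tychonov_cube T) f"
    and cl: "\<And>k. k \<in> T \<Longrightarrow> closedin X (P k)" "\<And>k. k \<in> T \<Longrightarrow> closedin X (Q k)"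
    and disj: "\<And>k. k \<in> T \<Longrightarrow> P k \<inter> Q k = {}" "\<And>k. k \<in> T \<Longrightarrow> (P k \<union> Q k) \<inter> Y = {}"
  shows "\<exists>h e. continuous_map X (tychonov_cube T) h \<and> (\<forall>y\<in>Y. h y = f y) \<and> inj_on e T \<and> e ` T \<subseteq> T \<and>
    (\<forall>k\<in>T. h ` (P k \<union> Q k) \<inter> Z = {} \<and> (\<forall>x\<in>P k. h x (e k) \<le> 1/4) \<and> (\<forall>x\<in>Q k. h x (e k) \<ge> 3/4))"
proof (cases "countable T")
  case True
  show ?thesis by (rule general_position_countable[OF \<tau>(1,2) Z True T X Y f cl disj])
next
  case False
  have "natLeq <o \<tau>"
  proof (rule ccontr)
    assume not_less: "\<not> natLeq <o \<tau>"
    have "Well_order \<tau>" using \<tau>(1) by (simp only: card_order_on_def)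
    then have "\<tau> \<le>o natLeq"
      by (rule iffD1[OF not_ordLess_iff_ordLeq[OF _ natLeq_Well_order] not_less])
    from ordIso_ordLeq_trans[OF \<tau>(3) this]
    have "|T| \<le>o |UNIV :: nat set|"
      by (rule ordLeq_ordIso_trans[OF _ ordIso_symmetric[OF card_of_nat]])
    then have "\<exists>f. inj_on f T \<and> f ` T \<subseteq> (UNIV :: nat set)" by (rule iffD2[OF card_of_ordLeq])
    then show False using False unfolding countable_def by blast
  qed
  then show ?thesis by (rule general_position_uncountable[OF \<tau>(1) _ \<tau>(3) Z T X Y f cl disj])
qed

lemma embedding_map_into_cube:
  assumes X: "compact_space X" and h: "continuous_map X (tychonov_cube T) h" and inj: "inj_on h (topspace X)"
  shows "embedding_map X (tychonov_cube T) h"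
proof (rule injective_closed_imp_embedding_map[OF h _ inj])
  show "closed_map X (tychonov_cube T) h"
    by (rule continuous_imp_closed_map_gen[OF X Hausdorff_imp_kc_space[OF Hausdorff_space_tychonov_cube] h])
qed

theorem proposition3p12:
  fixes T :: "'i set" and \<tau> :: "'k rel" and Z :: "('i \<Rightarrow> real) set"
    and X :: "'a topology" and Y :: "'a set" and f :: "'a \<Rightarrow> 'i \<Rightarrow> real"
  assumes "Card_order \<tau>" and "|T| =o \<tau>" and "natLeq \<le>o \<tau>"
    and "Z_set_in \<tau> (tychonov_cube T) Z"
    and "compactum X" and "topology_weight X \<le>o \<tau>"
    and "closedin X Y"
    and "continuous_map X (tychonov_cube T) f"
    and "f ` Y \<subseteq> Z"
    and "embedding_map (subtopology X Y) (subtopology (tychonov_cube T) Z) f"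
  shows "\<exists>h. Z_embedding \<tau> X (tychonov_cube T) h \<and>
             (\<forall>y \<in> Y. h y = f y) \<and>
             h ` (topspace X - Y) \<subseteq> topspace (tychonov_cube T) - Z"
proof -
  let ?I = "tychonov_cube T"
  note \<tau> = assms(1,3)
  have X: "compact_space X" "Hausdorff_space X" using assms(5) unfolding compactum_def by simp_all
  have Xn: "normal_space X" using X by (intro compact_Hausdorff_or_regular_imp_normal_space) simp_all
  have Xr: "regular_space X" by (rule compact_Hausdorff_imp_regular_space[OF X])
  have YX: "Y \<subseteq> topspace X" using assms(7) by (rule closedin_subset)
  have "natLeq \<le>o |T|" by (rule ordLeq_ordIso_trans[OF assms(3) ordIso_symmetric[OF assms(2)]])
  then have T: "infinite T" using infinite_iff_natLeq_ordLeq[of T] by simp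
  obtain \<B> where \<B>: "base_of_topology X \<B>" "|\<B>| \<le>o \<tau>"
    using assms(6) unfolding topology_weight_le_iff by blast
  have \<B>_open: "openin X U" if "U \<in> \<B>" for U
    using \<B>(1) that unfolding base_of_topology_def by blast
  have shrink: "\<exists>U\<in>\<B>. x \<in> U \<and> X closure_of U \<subseteq> W" if W: "openin X W" and x: "x \<in> W" for W x
  proof -
    have WX: "W \<subseteq> topspace X" using W by (rule openin_subset)
    have "closedin X (topspace X - W)" "x \<in> topspace X - (topspace X - W)" using W WX x by auto
    then obtain U0 where U0: "openin X U0" "x \<in> U0" "disjnt (topspace X - W) (X closure_of U0)"
      using Xr unfolding regular_space by blast
    obtain U where U: "U \<in> \<B>" "x \<in> U" "U \<subseteq> U0"
      using \<B>(1) U0(1,2) unfolding base_of_topology_def by blast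
    have "X closure_of U \<subseteq> W"
      using closure_of_mono[OF U(3), of X] closure_of_subset_topspace[of X U] U0(3) unfolding disjnt_def by blast
    with U show ?thesis by blast
  qed
  have \<B>T: "|\<B>| \<le>o |T|" by (rule ordLeq_ordIso_trans[OF \<B>(2) ordIso_symmetric[OF assms(2)]])
  have card_T: "Card_order |T|" by (rule card_of_Card_order)
  have "infinite (Field |T| )" unfolding Field_card_of by (rule T)
  note times = card_of_Times_ordLeq_infinite_Field[OF this \<B>T _ card_T]
  have "|\<B> \<times> \<B> \<times> T| \<le>o |T|" by (rule times[OF times[OF ordLeq_refl[OF card_T]]])
  then have "\<exists>i. inj_on i (\<B> \<times> \<B> \<times> T) \<and> i ` (\<B> \<times> \<B> \<times> T) \<subseteq> T" by (rule iffD2[OF card_of_ordLeq])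
  then obtain i where i: "inj_on i (\<B> \<times> \<B> \<times> T)" "i ` (\<B> \<times> \<B> \<times> T) \<subseteq> T" by blast
  \<comment> \<open>The third component repeats every pair of basic sets once for each element of \<open>T\<close>. Indices outside the
      range of \<open>i\<close> get arbitrary tasks; closedness and disjointness are built into \<open>P\<close> and \<open>Q\<close> for all of them.\<close>
  define task where "task = inv_into (\<B> \<times> \<B> \<times> T) i"
  have task: "task (i (U, V, s)) = (U, V, s)" if "U \<in> \<B>" "V \<in> \<B>" "s \<in> T" for U V s
    unfolding task_def by (rule inv_into_f_f[OF i(1)]) (use that in simp)
  have iT: "i (U, V, s) \<in> T" if "U \<in> \<B>" "V \<in> \<B>" "s \<in> T" for U V s
    using i(2) that by blast
  let ?cl = "\<lambda>U. X closure_of U"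
  define P where "P k = (let C = ?cl (fst (task k)) in if C \<inter> Y = {} then C else {})" for k
  define Q where "Q k = (let C = ?cl (fst (task k)); D = ?cl (fst (snd (task k))) in
      if D \<inter> Y = {} \<and> C \<inter> D = {} then D else {})" for k
  have PQ: "closedin X (P k)" "closedin X (Q k)" for k
    unfolding P_def Q_def Let_def by (simp_all add: closedin_closure_of)
  have "P k \<inter> Y = {}" "Q k \<inter> Y = {}" for k
    unfolding P_def Q_def Let_def by simp_all
  moreover have "P k \<inter> Q k = {}" for k
  proof (cases "?cl (fst (task k)) \<inter> ?cl (fst (snd (task k))) = {}")
    case True
    have "P k \<subseteq> ?cl (fst (task k))" "Q k \<subseteq> ?cl (fst (snd (task k)))" unfolding P_def Q_def Let_def by simp_all
    then show ?thesis using True by blast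
  next
    case False
    then show ?thesis unfolding Q_def Let_def by simp
  qed
  ultimately have PQ_disjoint: "P k \<inter> Q k = {}" "(P k \<union> Q k) \<inter> Y = {}" for k
    by (simp_all add: Int_Un_distrib2)
  have "\<exists>h e. continuous_map X ?I h \<and> (\<forall>y\<in>Y. h y = f y) \<and> inj_on e T \<and> e ` T \<subseteq> T \<and>
    (\<forall>k\<in>T. h ` (P k \<union> Q k) \<inter> Z = {} \<and> (\<forall>x\<in>P k. h x (e k) \<le> 1/4) \<and> (\<forall>x\<in>Q k. h x (e k) \<ge> 3/4))"
    by (rule general_position[where P=P and Q=Q, OF \<tau> assms(2,4) T Xn assms(7,8)]) (rule PQ PQ_disjoint)+
  then obtain h e where h: "continuous_map X ?I h" "\<forall>y\<in>Y. h y = f y" and e: "inj_on e T" "e ` T \<subseteq> T"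
    and he: "\<forall>k\<in>T. h ` (P k \<union> Q k) \<inter> Z = {} \<and> (\<forall>x\<in>P k. h x (e k) \<le> 1/4) \<and> (\<forall>x\<in>Q k. h x (e k) \<ge> 3/4)"
    by (elim exE conjE) (rule that)
  obtain s0 where s0: "s0 \<in> T" using T infinite_imp_nonempty by blast
  have outside: "openin X (topspace X - Y)" using assms(7) by blast
  have PU: "P (i (U, V, s)) = ?cl U" if "U \<in> \<B>" "V \<in> \<B>" "s \<in> T" "?cl U \<inter> Y = {}" for U V s
    unfolding P_def Let_def task[OF that(1-3)] using that(4) by simp
  have in_cl: "x \<in> ?cl U" if "U \<in> \<B>" "x \<in> U" for U x
    using closure_of_subset[OF openin_subset[OF \<B>_open[OF that(1)]]] that(2) by blast
  have shrink_Y: "\<exists>U\<in>\<B>. x \<in> U \<and> ?cl U \<inter> Y = {}" if "x \<in> topspace X - Y" for x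
    using shrink[OF outside that] by blast
  have h_off: "h x \<notin> Z" if x: "x \<in> topspace X - Y" for x
  proof -
    obtain U where U: "U \<in> \<B>" "x \<in> U" "?cl U \<inter> Y = {}" using shrink_Y[OF x] by blast
    have "x \<in> P (i (U, U, s0))" using PU[OF U(1,1) s0 U(3)] in_cl[OF U(1,2)] by simp
    then show ?thesis using he iT[OF U(1,1) s0] by blast
  qed
  have hY: "h ` Y \<subseteq> Z" using h(2) assms(9) by auto
  have f_inj: "inj_on f Y"
  proof -
    have "inj_on f (topspace (subtopology X Y))"
      using assms(10) unfolding embedding_map_def by (rule homeomorphic_imp_injective_map)
    then show ?thesis using YX by (simp add: Int_absorb1)
  qed
  have inj: "inj_on h (topspace X)"
  proof (rule inj_onI, rule ccontr)
    fix x x' assume x: "x \<in> topspace X" "x' \<in> topspace X" "h x = h x'" "x \<noteq> x'"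
    show False
    proof (cases "x \<in> Y")
      case True
      then have "h x' \<in> Z" using hY x(3) by auto
      then have x'Y: "x' \<in> Y" using h_off[of x'] x(2) by blast
      then have "f x = f x'" using h(2) True x(3) by simp
      then show False using inj_onD[OF f_inj _ True x'Y] x(4) by blast
    next
      case False
      have "h x \<notin> Z" using h_off[of x] x(1) False by blast
      then have x'Y: "x' \<notin> Y" using hY x(3) by auto
      have "closedin X {x'}" using X(2) x(2) by (rule closedin_Hausdorff_singleton)
      then have "openin X (topspace X - Y - {x'})" by (rule openin_diff[OF outside])
      moreover have "x \<in> topspace X - Y - {x'}" using x False by blast
      ultimately obtain U where U: "U \<in> \<B>" "x \<in> U" "?cl U \<subseteq> topspace X - Y - {x'}"
        using shrink by blast
      have "openin X (topspace X - Y - ?cl U)" by (rule openin_diff[OF outside closedin_closure_of])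
      moreover have "x' \<in> topspace X - Y - ?cl U" using x(2) x'Y U(3) by blast
      ultimately obtain V where V: "V \<in> \<B>" "x' \<in> V" "?cl V \<subseteq> topspace X - Y - ?cl U"
        using shrink by blast
      let ?k = "i (U, V, s0)"
      have k: "?k \<in> T" by (rule iT[OF U(1) V(1) s0])
      have "?cl U \<inter> Y = {}" using U(3) by blast
      then have "x \<in> P ?k" using PU[OF U(1) V(1) s0] in_cl[OF U(1,2)] by simp
      moreover have "?cl V \<inter> Y = {}" "?cl U \<inter> ?cl V = {}" using V(3) by blast+
      then have "x' \<in> Q ?k" unfolding Q_def Let_def task[OF U(1) V(1) s0] using in_cl[OF V(1,2)] by simp
      ultimately have "h x (e ?k) \<le> 1/4" "h x' (e ?k) \<ge> 3/4" using he k by blast+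
      then show False using x(3) by simp
    qed
  qed
  have "Z_set_in \<tau> ?I (h ` topspace X)"
  proof (rule Z_set_image_criterion[OF \<tau> assms(4) X(1) assms(7) h(1) hY])
    fix x and A :: "'i set" assume x: "x \<in> topspace X - Y" and A: "|A| <o \<tau>"
    obtain U where U: "U \<in> \<B>" "x \<in> U" "?cl U \<inter> Y = {}" using shrink_Y[OF x] by blast
    \<comment> \<open>The repetitions of the pair \<open>(U, U)\<close>, for which \<open>P\<close> is the closure of \<open>U\<close>, provide as many fresh coordinates
        as there are elements of \<open>T\<close>, so that \<open>A\<close> cannot contain all of them.\<close>
    define c where "c s = e (i (U, U, s))" for s
    have "inj_on c T"
    proof (rule inj_onI)
      fix s s' assume s: "s \<in> T" "s' \<in> T" "c s = c s'"
      then have "e (i (U, U, s)) = e (i (U, U, s'))" unfolding c_def by simp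
      then have "i (U, U, s) = i (U, U, s')"
        using iT[OF U(1,1) s(1)] iT[OF U(1,1) s(2)] by (rule inj_onD[OF e(1)])
      then have "task (i (U, U, s)) = task (i (U, U, s'))" by simp
      then show "s = s'" unfolding task[OF U(1,1) s(1)] task[OF U(1,1) s(2)] by simp
    qed
    moreover have "\<not> |T| \<le>o |A|"
    proof
      assume "|T| \<le>o |A|"
      then have "|T| <o \<tau>" using A by (rule ordLeq_ordLess_trans)
      from not_ordLess_ordIso[OF this] show False using assms(2) by simp
    qed
    ultimately have "\<exists>s\<in>T. c s \<notin> A" using card_of_ordLeqI[of c T A] by metis
    then obtain s where s: "s \<in> T" "c s \<notin> A" by blast
    have k: "i (U, U, s) \<in> T" by (rule iT[OF U(1,1) s(1)])
    have "c s \<in> T - A" using e(2) k s(2) unfolding c_def by blast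
    moreover have "h x' (c s) \<noteq> 1" if "x' \<in> U" for x'
    proof -
      have "x' \<in> P (i (U, U, s))" using PU[OF U(1,1) s(1) U(3)] in_cl[OF U(1) that] by simp
      then have "h x' (c s) \<le> 1/4" using he k unfolding c_def by blast
      then show ?thesis by simp
    qed
    ultimately show "\<exists>U t. openin X U \<and> x \<in> U \<and> t \<in> T - A \<and> (\<forall>x'\<in>U. h x' t \<noteq> 1)"
      using \<B>_open[OF U(1)] U(2) by (intro exI[of _ U] exI[of _ "c s"]) simp
  qed
  moreover have "embedding_map X ?I h" by (rule embedding_map_into_cube[OF X(1) h(1) inj])
  ultimately have "Z_embedding \<tau> X ?I h" unfolding Z_embedding_def by blast
  moreover have "h ` (topspace X - Y) \<subseteq> topspace ?I - Z"
  proof clarify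
    fix x assume x: "x \<in> topspace X" "x \<notin> Y"
    have "h x \<in> topspace ?I" using h(1) x(1) unfolding continuous_map_def by blast
    moreover have "h x \<notin> Z" using h_off x by blast
    ultimately show "h x \<in> topspace ?I - Z" by blast
  qed
  ultimately show ?thesis using h(2) by blast
qed

end
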